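(* Let $p\in\mathbb M_d(\mathbb C\langle x_1,\ldots,x_n\rangle)_h$ and let $B_1,\ldots,B_m\in\mathbb M_d(\mathbb C)_h$ be such that the real vector space $\operatorname{span}_{\mathbb R}\{B_1,\dots,B_m\}$ is an indefinite subspace of $\mathbb{M}_d(\mathbb{C})_h$. Then for any Hilbert space $\mathcal H$ and any choice of $T_1,\ldots, T_n\in\mathbb B(\mathcal H)_h$, the following are equivalent: (i) There exist $S_1,\ldots, S_m\in \mathbb B(\mathcal H)_h$ such that $p(T_1,\ldots, T_n)+ B_1\otimes S_1+\cdots +B_m\otimes S_m \geqslant 0.$ (ii) For all $r\in\mathbb N$ with $r\leq \dim(\mathcal H)$ and all finite families of matrices $W_j\in \mathbb M_{d,r}(\mathbb C)$ with $\sum_j W_j^*B_iW_j=0$ for all $i=1,\ldots,m$, we have $$\sum_{j} p_{W_j}(T_1,\ldots, T_n) \geqslant 0.$$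
   Context: $\mathbb C\langle x_1,\ldots,x_n\rangle$ is the algebra of polynomials in non-commuting variables with involution $*$ determined by $x_i^*=x_i$ and complex conjugation on $\mathbb C$; the involution extends to $\mathbb M_d(\mathbb C\langle x_1,\ldots,x_n\rangle)$ by transposing and applying $*$ entrywise. A subscript $h$ denotes the real vector space of Hermitian (self-adjoint) elements: $\mathbb M_d(\mathbb C\langle x_1,\ldots,x_n\rangle)_h$, $\mathbb M_d(\mathbb C)_h$, and $\mathbb B(\mathcal H)_h$ (bounded self-adjoint operators on a complex Hilbert space $\mathcal H$). $\mathbb M_{d,r}(\mathbb C)$ is the space of complex $d\times r$ matrices and $W^*$ is the conjugate transpose of $W$. Every $p\in\mathbb M_d(\mathbb C\langle x_1,\ldots,x_n\rangle)$ is a finite sum $p=\sum_\omega P_\omega\otimes\omega$ over words $\omega$ in $x_1,\dots,x_n$ (including the empty word), with $P_\omega\in\mathbb M_d(\mathbb C)$. Its evaluation at $T_1,\dots,T_n\in\mathbb B(\mathcal H)_h$ is $p(T_1,\ldots,T_n)=\sum_\omega P_\omega\otimes\omega(T_1,\ldots,T_n)$, a bounded operator on $\mathbb C^d\otimes\mathcal H$ (the empty word evaluates to $\mathrm{id}_{\mathcal H}$). For $W\in\mathbb M_{d,r}(\mathbb C)$ one sets $p_W:=\sum_\omega W^*P_\omega W\otimes\omega\in\mathbb M_r(\mathbb C\langle x_1,\ldots,x_n\rangle)$. $\geqslant 0$ means positive semidefinite. A Hermitian matrix is indefinite if it is neither positive semidefinite nor negative semidefinite. A real subspace $S\subseteq\mathbb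 M_d(\mathbb C)_h$ is called indefinite if every element of $S\setminus\{0\}$ is indefinite. *)

theory Defs
  imports
    "HOL-Analysis.Inner_Product"
    "HOL-Library.Extended_Nat"
    "HOL-Library.Poly_Mapping"
    "HOL-Library.Function_Algebras"
    "Jordan_Normal_Form.Schur_Decomposition"
begin

section \<open>The free \<open>*\<close>-algebra\<close>

datatype word = Word (letters: "nat list")

instantiation word :: monoid_add
begin

definition zero_word :: word where "0 = Word []"

text \<open>
  The free monoid is written additively, because \<^type>\<open>poly_mapping\<close> expects the exponents to form an
  additive monoid. With concatenation as \<open>+\<close>, the library product on \<open>word \<Rightarrow>\<^sub>0 complex\<close> is the
  (non-commutative) product of the free algebra.
\<close>
definition plus_word :: "word \<Rightarrow> word \<Rightarrow> word" where
  "v + w = Word (letters v @ letters w)"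

instance
  by standard (simp_all add: zero_word_def plus_word_def)

end

type_synonym ncpoly = "word \<Rightarrow>\<^sub>0 complex"

definition nc_var :: "nat \<Rightarrow> ncpoly" where
  "nc_var i = Poly_Mapping.single (Word [i]) 1"

text \<open>The words in the variables with indices \<open>1, \<dots>, n\<close>, and the free algebra on these variables.\<close>

definition words :: "nat \<Rightarrow> word set" where
  "words n = {w. set (letters w) \<subseteq> {1..n}}"

definition free_algebra :: "nat \<Rightarrow> ncpoly set" where
  "free_algebra n = {q. Poly_Mapping.keys q \<subseteq> words n}"

text \<open>
  The involution is spelled out on coefficients: the coefficient of \<open>w\<close> in \<open>q\<^sup>*\<close> is the conjugate of the
  coefficient in \<open>q\<close> of the reversed word. The lemmas below show that this is the conjugate-linear
  anti-automorphism which fixes every variable.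
\<close>

definition word_rev :: "word \<Rightarrow> word" where
  "word_rev w = Word (rev (letters w))"

lift_definition nc_star :: "ncpoly \<Rightarrow> ncpoly" is "\<lambda>q w. cnj (q (word_rev w))"
proof -
  fix q :: "word \<Rightarrow> complex"
  assume "finite {w. q w \<noteq> 0}"
  moreover have "{w. cnj (q (word_rev w)) \<noteq> 0} \<subseteq> word_rev ` {w. q w \<noteq> 0}"
    by (force simp: word_rev_def image_iff intro: exI[of _ "word_rev _"])
  ultimately show "finite {w. cnj (q (word_rev w)) \<noteq> 0}"
    by (meson finite_surj)
qed

lemma nc_star_single: "nc_star (Poly_Mapping.single w c) = Poly_Mapping.single (word_rev w) (cnj c)"
  by (rule poly_mapping_eqI)
    (auto simp: nc_star.rep_eq lookup_single when_def word_rev_def)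

lemma nc_star_var: "nc_star (nc_var i) = nc_var i"
  by (simp add: nc_var_def nc_star_single word_rev_def)

lemma nc_star_add: "nc_star (p + q) = nc_star p + nc_star q"
  by (rule poly_mapping_eqI) (simp add: nc_star.rep_eq lookup_add)

lemma nc_star_star: "nc_star (nc_star p) = p"
  by (rule poly_mapping_eqI) (simp add: nc_star.rep_eq word_rev_def)

lemma nc_star_mult: "nc_star (p * q) = nc_star q * nc_star p"
proof -
  have star_sum: "nc_star (sum f I) = (\<Sum>i\<in>I. nc_star (f i))" for f :: "word \<Rightarrow> ncpoly" and I
  proof -
    have "nc_star 0 = 0"
      by (rule poly_mapping_eqI) (simp add: nc_star.rep_eq)
    then show ?thesis
      by (induction I rule: infinite_finite_induct) (simp_all add: nc_star_add)
  qed
  have expand: "a = (\<Sum>w\<in>Poly_Mapping.keys a. Poly_Mapping.single w (Poly_Mapping.lookup a w))" for a :: ncpoly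
    by (rule poly_mapping_eqI)
      (auto simp: lookup_sum lookup_single when_def in_keys_iff if_distrib cong: if_cong)
  let ?s = "\<lambda>a w. Poly_Mapping.single w (Poly_Mapping.lookup a w) :: ncpoly"
  have "nc_star (p * q) = nc_star (\<Sum>v\<in>Poly_Mapping.keys p. \<Sum>w\<in>Poly_Mapping.keys q. ?s p v * ?s q w)"
    by (subst (1) expand[of p], subst (1) expand[of q]) (simp add: sum_product)
  also have "\<dots> = (\<Sum>v\<in>Poly_Mapping.keys p. \<Sum>w\<in>Poly_Mapping.keys q. nc_star (?s q w) * nc_star (?s p v))"
    by (simp add: star_sum mult_single nc_star_single word_rev_def plus_word_def mult.commute)
  also have "\<dots> = (\<Sum>w\<in>Poly_Mapping.keys q. nc_star (?s q w)) * (\<Sum>v\<in>Poly_Mapping.keys p. nc_star (?s p v))"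
    by (simp add: sum_product sum.swap[of _ "Poly_Mapping.keys p"])
  also have "\<dots> = nc_star q * nc_star p"
    by (simp add: star_sum[symmetric] expand[symmetric])
  finally show ?thesis .
qed


section \<open>Matrices\<close>

definition herm_mat :: "nat \<Rightarrow> complex mat set" where
  "herm_mat d = {A \<in> carrier_mat d d. mat_adjoint A = A}"

definition mat_psd :: "nat \<Rightarrow> complex mat \<Rightarrow> bool" where
  "mat_psd d A \<longleftrightarrow> A \<in> herm_mat d \<and> (\<forall>v\<in>carrier_vec d. 0 \<le> (A *\<^sub>v v) \<bullet>c v)"

definition mat_indefinite :: "nat \<Rightarrow> complex mat \<Rightarrow> bool" where
  "mat_indefinite d A \<longleftrightarrow> A \<in> herm_mat d \<and> \<not> mat_psd d A \<and> \<not> mat_psd d (- A)"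

definition real_subspace :: "nat \<Rightarrow> complex mat set \<Rightarrow> bool" where
  "real_subspace d S \<longleftrightarrow> S \<subseteq> herm_mat d \<and> 0\<^sub>m d d \<in> S
     \<and> (\<forall>A\<in>S. \<forall>B\<in>S. A + B \<in> S) \<and> (\<forall>c. \<forall>A\<in>S. complex_of_real c \<cdot>\<^sub>m A \<in> S)"

definition indefinite_subspace :: "nat \<Rightarrow> complex mat set \<Rightarrow> bool" where
  "indefinite_subspace d S \<longleftrightarrow> real_subspace d S \<and> (\<forall>A \<in> S - {0\<^sub>m d d}. mat_indefinite d A)"

text \<open>
  The type \<^typ>\<open>complex mat\<close> has no zero common to all sizes, so \<^const>\<open>sum\<close> does not apply to it;
  this is the sum of a family of \<open>r \<times> s\<close> matrices.
\<close>
definition mat_sum :: "nat \<Rightarrow> nat \<Rightarrow> ('i \<Rightarrow> complex mat) \<Rightarrow> 'i set \<Rightarrow> complex mat" where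
  "mat_sum r s F I = mat r s (\<lambda>(a, b). \<Sum>i\<in>I. F i $$ (a, b))"

definition real_span :: "nat \<Rightarrow> nat \<Rightarrow> (nat \<Rightarrow> complex mat) \<Rightarrow> complex mat set" where
  "real_span d m B = {mat_sum d d (\<lambda>i. complex_of_real (c i) \<cdot>\<^sub>m B i) {1..m} | c. True}"


section \<open>Matrices over the free algebra\<close>

definition nc_mat_star :: "ncpoly mat \<Rightarrow> ncpoly mat" where
  "nc_mat_star p = mat (dim_col p) (dim_row p) (\<lambda>(a, b). nc_star (p $$ (b, a)))"

definition nc_mat :: "nat \<Rightarrow> nat \<Rightarrow> ncpoly mat set" where
  "nc_mat d n = {p \<in> carrier_mat d d. elements_mat p \<subseteq> free_algebra n}"

definition nc_herm_mat :: "nat \<Rightarrow> nat \<Rightarrow> ncpoly mat set" where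
  "nc_herm_mat d n = {p \<in> nc_mat d n. nc_mat_star p = p}"

text \<open>
  In \<open>p = (\<Sum>w. P\<^sub>w \<otimes> w)\<close>, the matrix \<open>P\<^sub>w\<close> is \<open>nc_coeff p w\<close>, and \<open>nc_support p\<close> is the
  finite set of words \<open>w\<close> with \<open>P\<^sub>w \<noteq> 0\<close>.
\<close>

definition nc_coeff :: "ncpoly mat \<Rightarrow> word \<Rightarrow> complex mat" where
  "nc_coeff p w = map_mat (\<lambda>q. Poly_Mapping.lookup q w) p"

definition nc_support :: "ncpoly mat \<Rightarrow> word set" where
  "nc_support p = (\<Union>q\<in>elements_mat p. Poly_Mapping.keys q)"

text \<open>\<open>p\<^sub>W = (\<Sum>w. W\<^sup>* P\<^sub>w W \<otimes> w)\<close>\<close>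

definition nc_compress :: "complex mat \<Rightarrow> ncpoly mat \<Rightarrow> ncpoly mat" where
  "nc_compress W p = mat (dim_col W) (dim_col W)
     (\<lambda>(a, b). \<Sum>w\<in>nc_support p.
        Poly_Mapping.single w ((mat_adjoint W * nc_coeff p w * W) $$ (a, b)))"


section \<open>Complex Hilbert spaces\<close>

text \<open>
  A complex Hilbert space is built on top of the library's real one, so that norm, topology and
  completeness come from there. The inner product \<open>cinner\<close> is conjugate linear in its first argument,
  and its real part is the underlying real inner product.
\<close>

class complex_hilbert_space = real_inner + complete_space +
  fixes scaleC :: "complex \<Rightarrow> 'a \<Rightarrow> 'a"  (infixr \<open>*\<^sub>C\<close> 75)
    and cinner :: "'a \<Rightarrow> 'a \<Rightarrow> complex"
  assumes scaleC_add_right: "a *\<^sub>C (x + y) = a *\<^sub>C x + a *\<^sub>C y"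
    and scaleC_add_left: "(a + b) *\<^sub>C x = a *\<^sub>C x + b *\<^sub>C x"
    and scaleC_scaleC: "a *\<^sub>C b *\<^sub>C x = (a * b) *\<^sub>C x"
    and scaleR_scaleC: "c *\<^sub>R x = complex_of_real c *\<^sub>C x"
    and cinner_commute: "cinner x y = cnj (cinner y x)"
    and cinner_add_right: "cinner x (y + z) = cinner x y + cinner x z"
    and cinner_scaleC_right: "cinner x (a *\<^sub>C y) = a * cinner x y"
    and Re_cinner: "Re (cinner x y) = inner x y"

instantiation complex :: complex_hilbert_space
begin

definition scaleC_complex :: "complex \<Rightarrow> complex \<Rightarrow> complex" where
  "scaleC_complex a x = a * x"

definition cinner_complex :: "complex \<Rightarrow> complex \<Rightarrow> complex" where
  "cinner_complex x y = cnj x * y"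

instance
  by standard
    (simp_all add: scaleC_complex_def cinner_complex_def algebra_simps scaleR_conv_of_real inner_complex_def)

end

global_interpretation complex_vector: vector_space "scaleC :: complex \<Rightarrow> 'a \<Rightarrow> 'a::complex_hilbert_space"
proof
  fix x :: 'a
  show "1 *\<^sub>C x = x"
    using scaleR_scaleC[of 1 x] by simp
qed (rule scaleC_add_right scaleC_add_left scaleC_scaleC)+

text \<open>
  The dimension, with all infinite cardinals identified; \<open>complex_vector.dim\<close> alone would be \<open>0\<close> on
  an infinite-dimensional space.
\<close>
definition hilbert_dim :: "'h::complex_hilbert_space itself \<Rightarrow> enat" where
  "hilbert_dim _ =
     (if \<exists>B :: 'h set. finite B \<and> complex_vector.span B = UNIV
      then enat (complex_vector.dim (UNIV :: 'h set)) else \<infinity>)"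

definition bounded_ops :: "('h::complex_hilbert_space \<Rightarrow> 'h) set" where
  "bounded_ops = {T. bounded_linear T \<and> (\<forall>a x. T (a *\<^sub>C x) = a *\<^sub>C T x)}"

definition herm_ops :: "('h::complex_hilbert_space \<Rightarrow> 'h) set" where
  "herm_ops = {T \<in> bounded_ops. \<forall>x y. cinner (T x) y = cinner x (T y)}"


section \<open>Operators on \<open>\<complex>\<^sup>d \<otimes> H\<close>\<close>

text \<open>
  \<open>\<complex>\<^sup>d \<otimes> H\<close> is realised as \<open>H\<^sup>d\<close>, with \<open>e\<^sub>i \<otimes> x\<close> the tuple that has \<open>x\<close> in position \<open>i\<close>.
  Tuples are functions on \<^typ>\<open>nat\<close> that vanish from \<open>d\<close> on, because the number of components is not
  fixed by the type: it is quantified over in the theorem. Matrix and tuple indices start at \<open>0\<close>,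
  as in the matrix library. Operators are added pointwise.
\<close>

definition tensor_space :: "nat \<Rightarrow> (nat \<Rightarrow> 'h::complex_hilbert_space) set" where
  "tensor_space d = {v. \<forall>i\<ge>d. v i = 0}"

definition tensor_cinner :: "nat \<Rightarrow> (nat \<Rightarrow> 'h::complex_hilbert_space) \<Rightarrow> (nat \<Rightarrow> 'h) \<Rightarrow> complex" where
  "tensor_cinner d u v = (\<Sum>i<d. cinner (u i) (v i))"

definition tensor_op ::
    "complex mat \<Rightarrow> ('h::complex_hilbert_space \<Rightarrow> 'h) \<Rightarrow> (nat \<Rightarrow> 'h) \<Rightarrow> (nat \<Rightarrow> 'h)" where
  "tensor_op P T v = (\<lambda>i. if i < dim_row P then \<Sum>j<dim_col P. P $$ (i, j) *\<^sub>C T (v j) else 0)"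

definition op_psd :: "nat \<Rightarrow> ((nat \<Rightarrow> 'h::complex_hilbert_space) \<Rightarrow> (nat \<Rightarrow> 'h)) \<Rightarrow> bool" where
  "op_psd d A \<longleftrightarrow> (\<forall>v\<in>tensor_space d. 0 \<le> tensor_cinner d v (A v))"

definition word_eval :: "(nat \<Rightarrow> 'h \<Rightarrow> 'h) \<Rightarrow> word \<Rightarrow> 'h \<Rightarrow> 'h" where
  "word_eval T w = foldr (\<lambda>i A. T i \<circ> A) (letters w) id"

definition nc_eval ::
    "ncpoly mat \<Rightarrow> (nat \<Rightarrow> 'h::complex_hilbert_space \<Rightarrow> 'h) \<Rightarrow> (nat \<Rightarrow> 'h) \<Rightarrow> (nat \<Rightarrow> 'h)" where
  "nc_eval p T = (\<Sum>w\<in>nc_support p. tensor_op (nc_coeff p w) (word_eval T w))"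

end

theory Submission
  imports Defs
begin

text \<open>
  To a tuple \<open>v = (v\<^sub>a)\<close> in \<open>H\<^sup>d = \<complex>\<^sup>d \<otimes> H\<close> belong the number \<open>q(v) = \<langle>v, p(T) v\<rangle>\<close> and the \<open>m\<close>
  self-adjoint finite rank operators \<open>M\<^sub>i(v) = \<Sum>\<^sub>a\<^sub>b B\<^sub>i(a, b) |v\<^sub>b\<rangle>\<langle>v\<^sub>a|\<close> on \<open>H\<close>, the partial traces of
  \<open>(B\<^sub>i \<otimes> 1) |v\<rangle>\<langle>v|\<close>. They are chosen so that \<open>\<langle>v, (B\<^sub>i \<otimes> S\<^sub>i) v\<rangle> = tr (S\<^sub>i M\<^sub>i(v))\<close>. In these terms the two
  conditions are dual to each other:

  \<^item> (i) asks for bounded self-adjoint \<open>S\<^sub>i\<close> such that the linear functional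
    \<open>\<phi> = - \<Sum>\<^sub>i tr (S\<^sub>i \<cdot>)\<close> satisfies \<open>\<phi> (M(v)) \<le> q(v)\<close> for all \<open>v\<close>;
  \<^item> (ii) says that \<open>\<Sum>\<^sub>k M(v\<^sub>k) = 0\<close> forces \<open>\<Sum>\<^sub>k q(v\<^sub>k) \<ge> 0\<close> for every finite family of tuples. Indeed, in
    an orthonormal basis of the span of all entries, \<open>v\<^sub>k\<close> is a matrix \<open>W\<^sub>k\<close> applied to the basis,
    \<open>\<Sum>\<^sub>k M\<^sub>i(v\<^sub>k) = 0\<close> becomes \<open>\<Sum>\<^sub>k W\<^sub>k\<^sup>* B\<^sub>i W\<^sub>k = 0\<close>, and \<open>\<Sum>\<^sub>k q(v\<^sub>k)\<close> becomes the value of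
    \<open>\<Sum>\<^sub>k p\<^bsub>W\<^sub>k\<^esub>(T)\<close> on the basis (\<open>evaluation_nonneg_of_moment_zero\<close>).

  From (i) to (ii) one only has to sum over the family. The converse is a Hahn-Banach argument
  (\<open>linear_below_convex_cone\<close>): the infimum of \<open>\<Sum>\<^sub>k q(v\<^sub>k)\<close> over all families with \<open>\<Sum>\<^sub>k M(v\<^sub>k) = x\<close> is
  sublinear in \<open>x\<close>, and a linear functional below it is the required \<open>\<phi>\<close>. For the infimum to be finite,
  the sums \<open>\<Sum>\<^sub>k M(v\<^sub>k)\<close>, which a priori form a convex cone, have to form a vector space. This is where
  indefiniteness enters. The cone in \<open>\<real>\<^sup>m\<close> generated by the vectors \<open>(z\<^sup>* B\<^sub>i z)\<^sub>i\<close> is a subspace, because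
  a functional \<open>s\<close> that is nonnegative on it makes \<open>\<Sum>\<^sub>i s\<^sub>i B\<^sub>i\<close> positive semidefinite, hence zero
  (\<open>form_vec_cone_symmetric\<close>), and the parallelogram law carries this over to the cone of the \<open>M(v)\<close>
  (\<open>moment_cone_symmetric\<close>).

  The functional \<open>\<phi>\<close> is purely algebraic. Since the cone in \<open>\<real>\<^sup>m\<close> contains a vector \<open>k\<close> together with
  \<open>- k\<close>, the inequality \<open>\<phi> (M(v)) \<le> q(v)\<close> at elementary tensors bounds \<open>x \<mapsto> \<phi> (k \<otimes> |x\<rangle>\<langle>x|)\<close> from both
  sides by a multiple of \<open>\<parallel>x\<parallel>\<^sup>2\<close>, and the Riesz representation theorem turns these forms into bounded
  self-adjoint operators (\<open>operators_of_moment_positivity\<close>). The argument takes place in \<open>H\<close> itself,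
  whatever its dimension.
\<close>


section \<open>Linear functionals below convex cones, and the Riesz representation\<close>

text \<open>
  Families of quadratic forms are functions; as vectors they come with the linear algebra of the
  library, in particular bases of subspaces and projections.
\<close>
instantiation "fun" :: (type, real_vector) real_vector
begin

definition scaleR_fun :: "real \<Rightarrow> ('a \<Rightarrow> 'b) \<Rightarrow> 'a \<Rightarrow> 'b" where
  "scaleR_fun c f = (\<lambda>x. c *\<^sub>R f x)"

instance
  by standard (auto simp: scaleR_fun_def fun_eq_iff algebra_simps)

end

definition sublinear :: "('a::real_vector \<Rightarrow> real) \<Rightarrow> bool" where
  "sublinear q \<longleftrightarrow>
     (\<forall>x y. q (x + y) \<le> q x + q y) \<and> (\<forall>t>0. \<forall>x. q (t *\<^sub>R x) = t * q x)"

lemma sublinear_ge: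
  assumes "sublinear q"
  shows "- q (- x) \<le> q x"
proof -
  have "q ((2::real) *\<^sub>R (0::'a)) = 2 * q 0"
    using assms unfolding sublinear_def by (metis zero_less_numeral)
  then have "q 0 = 0" by simp
  moreover have "q (x + (- x)) \<le> q x + q (- x)"
    using assms unfolding sublinear_def by blast
  ultimately show ?thesis by simp
qed

text \<open>
  The sublinear functions below all arise as infima of sets of values: along a chain of functions,
  along a ray, or over the fibres of a cone. The set may depend on the argument in any way that
  respects sums and positive multiples.
\<close>
lemma sublinear_Inf:
  fixes Q :: "'a::real_vector \<Rightarrow> real set"
  assumes ne: "\<And>x. Q x \<noteq> {}"
    and bdd: "\<And>x. bdd_below (Q x)"
    and add: "\<And>x y a b. a \<in> Q x \<Longrightarrow> b \<in> Q y \<Longrightarrow> \<exists>c\<in>Q (x + y). c \<le> a + b"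
    and scale: "\<And>x a t. a \<in> Q x \<Longrightarrow> t > 0 \<Longrightarrow> \<exists>c\<in>Q (t *\<^sub>R x). c \<le> t * a"
  shows "sublinear (\<lambda>x. Inf (Q x))"
  unfolding sublinear_def
proof (intro conjI allI impI)
  fix x y
  have "Inf (Q (x + y)) - b \<le> Inf (Q x)" if "b \<in> Q y" for b
    using add[OF _ that] cInf_lower2[OF _ _ bdd]
    by (intro cInf_greatest[OF ne]) (fastforce simp: algebra_simps)
  then have "Inf (Q (x + y)) - Inf (Q x) \<le> Inf (Q y)"
    by (intro cInf_greatest[OF ne]) (fastforce simp: algebra_simps)
  then show "Inf (Q (x + y)) \<le> Inf (Q x) + Inf (Q y)" by simp
next
  have le: "Inf (Q (t *\<^sub>R x)) \<le> t * Inf (Q x)" if "t > 0" for t x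
  proof -
    have "Inf (Q (t *\<^sub>R x)) / t \<le> Inf (Q x)"
      using scale[OF _ that] cInf_lower2[OF _ _ bdd] that
      by (intro cInf_greatest[OF ne]) (fastforce simp: field_simps)
    then show ?thesis using that by (simp add: field_simps)
  qed
  fix t :: real and x assume t: "t > 0"
  have "Inf (Q ((1 / t) *\<^sub>R (t *\<^sub>R x))) \<le> (1 / t) * Inf (Q (t *\<^sub>R x))"
    by (rule le) (use t in simp)
  then have "t * Inf (Q x) \<le> Inf (Q (t *\<^sub>R x))"
    using t by (simp add: field_simps)
  then show "Inf (Q (t *\<^sub>R x)) = t * Inf (Q x)"
    using le[OF t, of x] by simp
qed

text \<open>
  Fix \<open>y\<close>. The function \<open>x \<mapsto> inf\<^bsub>t \<ge> 0\<^esub> (m (x + t y) - t m y)\<close> is again sublinear and lies below \<open>m\<close>, so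
  it equals \<open>m\<close>. The value at \<open>t = 1\<close> then says \<open>m x + m y \<le> m (x + y)\<close>, the converse of
  subadditivity.
\<close>
lemma minimal_sublinear_linear:
  assumes m: "sublinear m"
    and min: "\<And>p. sublinear p \<Longrightarrow> p \<le> m \<Longrightarrow> p = m"
  shows "linear m"
proof -
  have sub: "m (x + y) \<le> m x + m y" and hom: "t > 0 \<Longrightarrow> m (t *\<^sub>R x) = t * m x" for x y t
    using m unfolding sublinear_def by blast+
  have m0: "m 0 = 0" using hom[of 2 0] by simp
  have super: "m x + m y \<le> m (x + y)" for x y
  proof -
    define Q where "Q x = (\<lambda>t. m (x + t *\<^sub>R y) - t * m y) ` {0..}" for x
    define p where "p x = Inf (Q x)" for x
    \<comment> \<open>a bound independent of the parameter along the ray keeps the infimum finite\<close>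
    have low: "- m (- x) \<le> a" if "a \<in> Q x" for x a
    proof -
      from that obtain t where t: "t \<ge> 0" "a = m (x + t *\<^sub>R y) - t * m y"
        unfolding Q_def by auto
      have "m ((x + t *\<^sub>R y) + (- x)) \<le> m (x + t *\<^sub>R y) + m (- x)" by (rule sub)
      moreover have "m (t *\<^sub>R y) = t * m y" using t hom[of t y] m0 by (cases "t = 0") auto
      ultimately show ?thesis using t by simp
    qed
    have bdd: "bdd_below (Q x)" for x using low by (meson bdd_belowI)
    have "sublinear p"
      unfolding p_def
    proof (rule sublinear_Inf[OF _ bdd])
      show "Q x \<noteq> {}" for x unfolding Q_def by auto
    next
      fix u v a b assume "a \<in> Q u" "b \<in> Q v"
      then obtain s t where s: "s \<ge> 0" "a = m (u + s *\<^sub>R y) - s * m y"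
        and t: "t \<ge> 0" "b = m (v + t *\<^sub>R y) - t * m y" unfolding Q_def by auto
      have "m ((u + v) + (s + t) *\<^sub>R y) - (s + t) * m y \<in> Q (u + v)"
        unfolding Q_def using s t by auto
      moreover have "m ((u + v) + (s + t) *\<^sub>R y) - (s + t) * m y \<le> a + b"
        using sub[of "u + s *\<^sub>R y" "v + t *\<^sub>R y"] s t by (simp add: algebra_simps)
      ultimately show "\<exists>c\<in>Q (u + v). c \<le> a + b" by blast
    next
      fix u a and t :: real assume "a \<in> Q u" and t: "t > 0"
      then obtain s where s: "s \<ge> 0" "a = m (u + s *\<^sub>R y) - s * m y" unfolding Q_def by auto
      have "m (t *\<^sub>R u + (t * s) *\<^sub>R y) - (t * s) * m y \<in> Q (t *\<^sub>R u)"
        unfolding Q_def using s t by auto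
      moreover have "m (t *\<^sub>R u + (t * s) *\<^sub>R y) - (t * s) * m y = t * a"
        unfolding s(2) right_diff_distrib hom[OF t, symmetric] by (simp add: algebra_simps)
      ultimately show "\<exists>c\<in>Q (t *\<^sub>R u). c \<le> t * a" by force
    qed
    moreover have "p \<le> m"
    proof (rule le_funI)
      fix u
      have "m (u + 0 *\<^sub>R y) - 0 * m y \<in> Q u" unfolding Q_def by (rule imageI) simp
      then show "p u \<le> m u" unfolding p_def using cInf_lower[OF _ bdd] by fastforce
    qed
    ultimately have "p = m" by (rule min)
    moreover have "p x \<le> m (x + 1 *\<^sub>R y) - 1 * m y"
      unfolding p_def by (rule cInf_lower[OF _ bdd]) (unfold Q_def, rule imageI, simp)
    ultimately show ?thesis by simp
  qed
  have add: "m (x + y) = m x + m y" for x y using sub super by (simp add: order_antisym)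
  have neg: "m (- x) = - m x" for x using add[of x "- x"] m0 by simp
  have "m (c *\<^sub>R x) = c * m x" for c x
  proof -
    consider "c > 0" | "c = 0" | "c < 0" by linarith
    then show ?thesis
    proof cases
      case 3
      then show ?thesis using hom[of "- c" x] neg[of "c *\<^sub>R x"] by simp
    qed (use hom m0 in auto)
  qed
  then show ?thesis using add by (intro linearI) auto
qed

text \<open>
  The Hahn-Banach theorem. Below a sublinear function there is a minimal one, since a chain of
  sublinear functions below \<open>q\<close> is bounded below pointwise by \<open>x \<mapsto> - q (- x)\<close>.
\<close>
lemma sublinear_dominates_linear:
  fixes q :: "'a::real_vector \<Rightarrow> real"
  assumes q: "sublinear q"
  shows "\<exists>\<phi>. linear \<phi> \<and> \<phi> \<le> q"
proof -
  define A where "A = {p. sublinear p \<and> p \<le> q}"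
  have "\<exists>m\<in>A. \<forall>a\<in>A. m \<ge> a \<longrightarrow> a = m"
  proof (rule predicate_Zorn)
    show "partial_order_on A (relation_of (\<ge>) A)"
      by (rule partial_order_on_relation_ofI) auto
  next
    fix C assume C: "C \<in> Chains (relation_of (\<ge>) A)"
    then have tot: "p \<le> p' \<or> p' \<le> p" if "p \<in> C" "p' \<in> C" for p p'
      using that by (auto simp: Chains_def relation_of_def)
    have CA: "C \<subseteq> A" using C by (auto simp: Chains_def relation_of_def)
    show "\<exists>u\<in>A. \<forall>a\<in>C. a \<ge> u"
    proof (cases "C = {}")
      case True
      then show ?thesis using q by (auto simp: A_def)
    next
      case False
      define Q where "Q x = (\<lambda>p. p x) ` C" for x
      have low: "- q (- x) \<le> p x" if "p \<in> C" for p x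
      proof -
        have "p (- x) \<le> q (- x)" "- p (- x) \<le> p x"
          using that CA sublinear_ge[of p x] by (auto simp: A_def le_fun_def)
        then show ?thesis by linarith
      qed
      have bdd: "bdd_below (Q x)" for x using low by (auto intro!: bdd_belowI simp: Q_def)
      have "sublinear (\<lambda>x. Inf (Q x))"
      proof (rule sublinear_Inf[OF _ bdd])
        show "Q x \<noteq> {}" for x using False by (auto simp: Q_def)
      next
        fix x y a b assume "a \<in> Q x" "b \<in> Q y"
        then obtain p p' where p: "p \<in> C" "a = p x" "p' \<in> C" "b = p' y" by (auto simp: Q_def)
        then obtain r where r: "r \<in> C" "r \<le> p" "r \<le> p'" using tot by blast
        have "r (x + y) \<le> r x + r y" using r CA by (auto simp: A_def sublinear_def)
        also have "\<dots> \<le> a + b" using r p by (simp add: le_fun_def add_mono)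
        finally show "\<exists>c\<in>Q (x + y). c \<le> a + b" using r by (auto simp: Q_def)
      next
        fix x a and t :: real assume "a \<in> Q x" "t > 0"
        then obtain p where p: "p \<in> C" "a = p x" by (auto simp: Q_def)
        then have "p (t *\<^sub>R x) = t * a"
          using CA \<open>t > 0\<close> by (auto simp: A_def sublinear_def)
        then show "\<exists>c\<in>Q (t *\<^sub>R x). c \<le> t * a"
          using p by (auto simp: Q_def intro!: bexI[of _ p])
      qed
      moreover have le: "(\<lambda>x. Inf (Q x)) \<le> p" if "p \<in> C" for p
        using that by (auto intro!: le_funI cInf_lower bdd[unfolded Q_def] simp: Q_def)
      moreover from False obtain p where "p \<in> C" by blast
      then have "p \<le> q" "(\<lambda>x. Inf (Q x)) \<le> p" using CA le by (auto simp: A_def)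
      ultimately show ?thesis by (intro bexI[of _ "\<lambda>x. Inf (Q x)"]) (auto simp: A_def)
    qed
  qed
  then obtain m where m: "m \<in> A" "\<And>a. a \<in> A \<Longrightarrow> a \<le> m \<Longrightarrow> a = m" by blast
  have "linear m"
    by (rule minimal_sublinear_linear) (use m in \<open>auto simp: A_def intro: order_trans\<close>)
  then show ?thesis using m by (auto simp: A_def)
qed

text \<open>
  A form of the Hahn-Banach theorem in which the sublinear function is not given, but arises from a
  convex cone \<open>Z\<close> as \<open>x \<mapsto> inf {t. (x, t) \<in> Z}\<close>. The hypothesis \<open>sym\<close> makes the projection \<open>E\<close> of
  \<open>Z\<close> a vector space, so that, together with \<open>pos\<close>, the infimum over each fibre above \<open>E\<close> is finite.
  Composed with a linear projection onto \<open>E\<close>, it is sublinear on the whole space.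
\<close>
lemma linear_below_convex_cone:
  fixes Z :: "('a::real_vector \<times> real) set"
  assumes zero: "(0, 0) \<in> Z"
    and add: "\<And>x s y t. (x, s) \<in> Z \<Longrightarrow> (y, t) \<in> Z \<Longrightarrow> (x + y, s + t) \<in> Z"
    and scale: "\<And>c x t. c > 0 \<Longrightarrow> (x, t) \<in> Z \<Longrightarrow> (c *\<^sub>R x, c * t) \<in> Z"
    and sym: "\<And>x t. (x, t) \<in> Z \<Longrightarrow> \<exists>s. (- x, s) \<in> Z"
    and pos: "\<And>t. (0, t) \<in> Z \<Longrightarrow> t \<ge> 0"
  shows "\<exists>\<phi>. linear \<phi> \<and> (\<forall>(x, t)\<in>Z. \<phi> x \<le> t)"
proof -
  define E where "E = fst ` Z"
  have "real_vector.subspace E"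
  proof (rule real_vector.subspaceI)
    show "0 \<in> E" unfolding E_def using zero by force
    show "x + y \<in> E" if "x \<in> E" "y \<in> E" for x y
      using that add unfolding E_def by force
    show "c *\<^sub>R x \<in> E" if x: "x \<in> E" for c x
    proof -
      have pos: "c *\<^sub>R x \<in> E" if "c > 0" "x \<in> E" for c x
        using that scale unfolding E_def by force
      have neg: "- x \<in> E" using x sym unfolding E_def by force
      consider "c > 0" | "c = 0" | "c < 0" by linarith
      then show ?thesis
      proof cases
        case 3
        then show ?thesis using pos[of "- c" "- x"] neg by simp
      qed (use pos x \<open>0 \<in> E\<close> in auto)
    qed
  qed
  then obtain g where g: "range g \<subseteq> E" "linear g" "\<And>x. x \<in> E \<Longrightarrow> g x = x"
    using real_vector.linear_exists_left_inverse_on[of id E]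
    by (auto simp: linear_id id_def module_hom_ident)
  define Q where "Q x = {t. (g x, t) \<in> Z}" for x
  have ne: "Q x \<noteq> {}" for x using g(1) unfolding Q_def E_def by force
  have bdd: "bdd_below (Q x)" for x
  proof -
    from ne[of x] obtain s where "(g x, s) \<in> Z" unfolding Q_def by auto
    then obtain s' where s': "(- g x, s') \<in> Z" using sym by blast
    have "- s' \<le> t" if "t \<in> Q x" for t
      using add[OF _ s', of "g x" t] pos[of "t + s'"] that unfolding Q_def by simp
    then show ?thesis by (meson bdd_belowI)
  qed
  have "sublinear (\<lambda>x. Inf (Q x))"
  proof (rule sublinear_Inf[OF ne bdd])
    fix x y a b assume "a \<in> Q x" "b \<in> Q y"
    then show "\<exists>c\<in>Q (x + y). c \<le> a + b"
      using add[of "g x" a "g y" b] by (auto simp: Q_def linear_add[OF g(2)])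
  next
    fix x a and t :: real assume "a \<in> Q x" "t > 0"
    then show "\<exists>c\<in>Q (t *\<^sub>R x). c \<le> t * a"
      using scale[of t "g x" a] by (auto simp: Q_def linear_scale[OF g(2)])
  qed
  then obtain \<phi> where \<phi>: "linear \<phi>" "\<phi> \<le> (\<lambda>x. Inf (Q x))"
    using sublinear_dominates_linear by blast
  have "\<phi> x \<le> t" if "(x, t) \<in> Z" for x t
  proof -
    have "g x = x" using that by (intro g(3)) (force simp: E_def)
    then have "Inf (Q x) \<le> t" using that by (intro cInf_lower bdd) (simp add: Q_def)
    then show ?thesis using \<phi>(2) by (metis le_funD order_trans)
  qed
  then show ?thesis using \<phi>(1) by auto
qed

text \<open>
  If \<open>x\<close> lies in \<open>K\<close> but \<open>- x\<close> does not, add to \<open>x\<close> a basis of the span of \<open>K\<close> that consists of elements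
  of \<open>K\<close>. The sum \<open>e\<close> is an order unit for \<open>K\<close>, and \<open>- e\<close> is still outside \<open>K\<close>. Then
  \<open>y \<mapsto> inf {t. t e - y \<in> K}\<close> is finite on the span, and a linear functional below it is nonnegative on \<open>K\<close> and at
  least \<open>1\<close> at \<open>e\<close>. Finite dimension replaces the closedness that a separation theorem would need.
\<close>
lemma finite_dim_cone_symmetric:
  fixes K :: "'a::real_vector set"
  assumes zero: "0 \<in> K"
    and add: "\<And>x y. x \<in> K \<Longrightarrow> y \<in> K \<Longrightarrow> x + y \<in> K"
    and scale: "\<And>c x. c > 0 \<Longrightarrow> x \<in> K \<Longrightarrow> c *\<^sub>R x \<in> K"
    and fin: "finite D" "K \<subseteq> real_vector.span D"
    and ann: "\<And>\<phi> :: 'a \<Rightarrow> real. linear \<phi> \<Longrightarrow> (\<And>x. x \<in> K \<Longrightarrow> \<phi> x \<ge> 0) \<Longrightarrow> (\<And>x. x \<in> K \<Longrightarrow> \<phi> x = 0)"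
    and x: "x \<in> K"
  shows "- x \<in> K"
proof (rule ccontr)
  assume nx: "- x \<notin> K"
  have scale0: "c *\<^sub>R y \<in> K" if "c \<ge> 0" "y \<in> K" for c y
    using that scale zero by (cases "c = 0") auto
  have sum: "sum f I \<in> K" if "\<And>i. i \<in> I \<Longrightarrow> f i \<in> K" for I and f :: "'a \<Rightarrow> 'a"
    using that by (induction I rule: infinite_finite_induct) (simp_all add: zero add)
  obtain C where C: "C \<subseteq> K" "independent C" "K \<subseteq> real_vector.span C"
    by (rule real_vector.maximal_independent_subset[of K]) blast
  have finC: "finite C"
    using real_vector.independent_span_bound[OF fin(1) C(2) subset_trans[OF C(1) fin(2)]] by simp
  define e where "e = x + \<Sum>C"
  have sumC: "\<Sum>C \<in> K" by (rule sum) (use C(1) in blast)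
  have eK: "e \<in> K" unfolding e_def by (rule add[OF x sumC])
  have unit: "\<exists>t. t *\<^sub>R e - k \<in> K" if k: "k \<in> K" for k
  proof -
    obtain c where c: "k = (\<Sum>b\<in>C. c b *\<^sub>R b)"
      using k C(3) unfolding real_vector.span_finite[OF finC] by blast
    define t where "t = (\<Sum>b\<in>C. \<bar>c b\<bar>)"
    have t: "c b \<le> t" if "b \<in> C" for b
    proof -
      have "\<bar>c b\<bar> \<le> t" unfolding t_def by (rule member_le_sum) (use that finC in auto)
      then show ?thesis by linarith
    qed
    have t0: "t \<ge> 0" by (auto simp: t_def sum_nonneg)
    have "t *\<^sub>R e - k = t *\<^sub>R x + (\<Sum>b\<in>C. (t - c b) *\<^sub>R b)"
      by (simp add: e_def c scaleR_add_right scaleR_sum_right scaleR_diff_left sum_subtractf)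
    also have "\<dots> \<in> K"
      by (rule add[OF scale0[OF t0 x] sum[OF scale0]]) (use t C(1) in auto)
    finally show ?thesis ..
  qed
  have ne: "- e \<notin> K"
  proof
    assume "- e \<in> K"
    then have "- e + \<Sum>C \<in> K" using sumC by (rule add)
    then show False using nx by (simp add: e_def)
  qed
  define Z where "Z = {(y, t). t *\<^sub>R e - y \<in> K \<and> (\<exists>s. s *\<^sub>R e + y \<in> K)}"
  have "\<exists>\<phi>. linear \<phi> \<and> (\<forall>(y, t)\<in>Z. \<phi> y \<le> t)"
  proof (rule linear_below_convex_cone)
    show "(0, 0) \<in> Z" unfolding Z_def using zero by (auto intro: exI[of _ 0])
  next
    fix y s z t assume yz: "(y, s) \<in> Z" "(z, t) \<in> Z"
    then obtain a b where "a *\<^sub>R e + y \<in> K" "b *\<^sub>R e + z \<in> K" by (auto simp: Z_def)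
    from add[OF this] have "(a + b) *\<^sub>R e + (y + z) \<in> K" by (simp add: algebra_simps)
    moreover have "(s + t) *\<^sub>R e - (y + z) \<in> K"
      using yz add[of "s *\<^sub>R e - y" "t *\<^sub>R e - z"] by (simp add: Z_def algebra_simps)
    ultimately show "(y + z, s + t) \<in> Z" by (auto simp: Z_def)
  next
    fix c y t assume c: "(c::real) > 0" and "(y, t) \<in> Z"
    then obtain a where "a *\<^sub>R e + y \<in> K" "t *\<^sub>R e - y \<in> K" by (auto simp: Z_def)
    from this[THEN scale[OF c]] have "(c * a) *\<^sub>R e + c *\<^sub>R y \<in> K" "(c * t) *\<^sub>R e - c *\<^sub>R y \<in> K"
      by (simp_all add: algebra_simps)
    then show "(c *\<^sub>R y, c * t) \<in> Z" by (auto simp: Z_def)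
  next
    fix y t assume "(y, t) \<in> Z"
    then obtain a where "a *\<^sub>R e + y \<in> K" "t *\<^sub>R e - y \<in> K" by (auto simp: Z_def)
    then show "\<exists>s. (- y, s) \<in> Z" by (auto simp: Z_def)
  next
    fix t :: real assume "(0, t) \<in> Z"
    then have te: "t *\<^sub>R e \<in> K" by (simp add: Z_def)
    show "t \<ge> 0"
    proof (rule ccontr)
      assume "\<not> t \<ge> 0"
      then show False using scale[of "1 / (- t)", OF _ te] ne by simp
    qed
  qed
  then obtain \<phi> where \<phi>: "linear \<phi>" "\<And>y t. (y, t) \<in> Z \<Longrightarrow> \<phi> y \<le> t" by blast
  have nonneg: "\<phi> k \<ge> 0" if k: "k \<in> K" for k
  proof -
    have "(- k, 0) \<in> Z" using that unit[OF that] by (simp add: Z_def)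
    from \<phi>(2)[OF this] show ?thesis by (simp add: linear_neg[OF \<phi>(1)])
  qed
  have "\<phi> e = 0" by (rule ann[OF \<phi>(1)]) (use nonneg eK in auto)
  moreover have "(- e, - 1) \<in> Z"
    by (auto simp: Z_def zero intro: exI[of _ 1])
  from \<phi>(2)[OF this] have "\<phi> e \<ge> 1" by (simp add: linear_neg[OF \<phi>(1)])
  ultimately show False by simp
qed

text \<open>
  The vector \<open>z\<close> is the minimiser of \<open>J x = \<parallel>x\<parallel>\<^sup>2 - 2 f x\<close>. A minimising sequence is a Cauchy sequence by
  the parallelogram law, and vanishing of the derivative of \<open>J\<close> at the limit is the claim.
\<close>
lemma Riesz_representation:
  fixes f :: "'a::{real_inner,complete_space} \<Rightarrow> real"
  assumes f: "bounded_linear f"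
  shows "\<exists>z. \<forall>x. f x = inner z x"
proof -
  interpret f: bounded_linear f by (rule f)
  obtain M where M: "\<And>x. \<bar>f x\<bar> \<le> norm x * M" using f.bounded by auto
  define J where "J x = inner x x - 2 * f x" for x
  have low: "- M\<^sup>2 \<le> J x" for x
  proof -
    have "0 \<le> (norm x - M)\<^sup>2" by simp
    then have "- M\<^sup>2 \<le> (norm x)\<^sup>2 - 2 * (norm x * M)" by (simp add: power2_diff)
    also have "\<dots> \<le> J x" unfolding J_def using M[of x] by (auto simp: power2_norm_eq_inner)
    finally show ?thesis .
  qed
  define c where "c = (INF x. J x)"
  have bdd: "bdd_below (range J)" by (rule bdd_belowI2) (rule low)
  have c: "c \<le> J x" for x unfolding c_def by (intro cINF_lower bdd) auto
  have "\<exists>x. J x < c + 1 / real (Suc n)" for n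
    unfolding c_def using cINF_less_iff[OF _ bdd, of "c + 1 / real (Suc n)"]
    by (auto simp: c_def)
  then obtain X where X: "\<And>n. J (X n) < c + 1 / real (Suc n)" by metis
  have par: "(norm (x - y))\<^sup>2 = 2 * J x + 2 * J y - 4 * J ((1/2) *\<^sub>R (x + y))" for x y
    unfolding J_def power2_norm_eq_inner
    by (simp add: inner_diff_left inner_diff_right inner_add_left inner_add_right f.add f.scaleR
        inner_commute field_simps)
  have close: "(norm (X i - X j))\<^sup>2 \<le> 4 / real (Suc n)" if "i \<ge> n" "j \<ge> n" for i j n
  proof -
    have "1 / real (Suc i) \<le> 1 / real (Suc n)" "1 / real (Suc j) \<le> 1 / real (Suc n)"
      using that by (auto simp: field_simps)
    then have "J (X i) \<le> c + 1 / real (Suc n)" "J (X j) \<le> c + 1 / real (Suc n)"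
      using X[of i] X[of j] by linarith+
    then show ?thesis unfolding par using c[of "(1/2) *\<^sub>R (X i + X j)"] by simp
  qed
  have "Cauchy X"
  proof (rule CauchyI)
    fix e :: real assume e: "e > 0"
    obtain n where n: "4 / e\<^sup>2 < real n" using reals_Archimedean2 by blast
    show "\<exists>M. \<forall>i\<ge>M. \<forall>j\<ge>M. norm (X i - X j) < e"
    proof (intro exI allI impI)
      fix i j assume ij: "i \<ge> n" "j \<ge> n"
      have "(norm (X i - X j))\<^sup>2 \<le> 4 / real (Suc n)" by (rule close[OF ij])
      also have "\<dots> < e\<^sup>2" using n e by (simp add: field_simps) (smt (verit) zero_less_power)
      finally show "norm (X i - X j) < e" using e by (simp add: power_less_imp_less_base)
    qed
  qed
  then obtain z where z: "X \<longlonglongrightarrow> z" using Cauchy_convergent convergent_def by blast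
  have "(\<lambda>n. J (X n)) \<longlonglongrightarrow> J z"
    unfolding J_def by (intro tendsto_intros z f.tendsto)
  moreover have "(\<lambda>n. c + 1 / real (Suc n)) \<longlonglongrightarrow> c + 0"
    by (intro tendsto_intros LIMSEQ_Suc lim_const_over_n)
  ultimately have "J z \<le> c + 0" by (rule LIMSEQ_le) (use X in \<open>auto intro: less_imp_le\<close>)
  then have min: "J z \<le> J x" for x using c[of x] by simp
  have "f x = inner z x" for x
  proof (cases "x = 0")
    case False
    define d where "d = f x - inner z x"
    \<comment> \<open>the step that minimises \<open>J (z + t x)\<close> in \<open>t\<close>\<close>
    define t where "t = d / inner x x"
    have pos: "inner x x > 0" using False by simp
    have "J (z + t *\<^sub>R x) = J z - 2 * t * d + t\<^sup>2 * inner x x"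
      unfolding J_def d_def
      by (simp add: inner_add_left inner_add_right f.add f.scaleR inner_commute power2_eq_square
          algebra_simps)
    also have "\<dots> = J z - d\<^sup>2 / inner x x"
      using pos unfolding t_def by (simp add: field_simps power2_eq_square)
    finally have "d\<^sup>2 / inner x x \<le> 0" using min[of "z + t *\<^sub>R x"] by simp
    then have "d = 0" using pos by (simp add: divide_le_0_iff)
    then show ?thesis by (simp add: d_def)
  qed (simp add: f.zero)
  then show ?thesis by blast
qed

section \<open>Complex Hilbert spaces\<close>

lemma cinner_add_left: "cinner (x + y) z = cinner x z + cinner y z"
  for x y z :: "'h::complex_hilbert_space"
  by (metis cinner_commute cinner_add_right complex_cnj_add)

lemma cinner_scaleC_left: "cinner (a *\<^sub>C x) y = cnj a * cinner x y"
  for x y :: "'h::complex_hilbert_space"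
  by (metis cinner_commute cinner_scaleC_right complex_cnj_mult)

lemma cinner_zero_right [simp]: "cinner x 0 = 0" for x :: "'h::complex_hilbert_space"
  using cinner_add_right[of x 0 0] by simp

lemma cinner_zero_left [simp]: "cinner 0 x = 0" for x :: "'h::complex_hilbert_space"
  using cinner_add_left[of 0 0 x] by simp

lemma cinner_minus_right: "cinner x (- y) = - cinner x y" for x y :: "'h::complex_hilbert_space"
  using cinner_add_right[of x y "- y"] by (simp add: eq_neg_iff_add_eq_0 add.commute)

lemma cinner_diff_right: "cinner x (y - z) = cinner x y - cinner x z"
  for x y z :: "'h::complex_hilbert_space"
  using cinner_add_right[of x y "- z"] by (simp add: cinner_minus_right)

lemma cinner_scaleR_right: "cinner x (c *\<^sub>R y) = of_real c * cinner x y"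
  for x y :: "'h::complex_hilbert_space"
  by (simp add: scaleR_scaleC cinner_scaleC_right)

lemma cinner_sum_right: "cinner x (\<Sum>i\<in>I. f i) = (\<Sum>i\<in>I. cinner x (f i))"
  for x :: "'h::complex_hilbert_space"
  by (induction I rule: infinite_finite_induct) (simp_all add: cinner_add_right)

lemma cinner_sum_left: "cinner (\<Sum>i\<in>I. f i) x = (\<Sum>i\<in>I. cinner (f i) x)"
  for x :: "'h::complex_hilbert_space"
  by (induction I rule: infinite_finite_induct) (simp_all add: cinner_add_left)

lemma cinner_self: "cinner x x = of_real ((norm x)\<^sup>2)" for x :: "'h::complex_hilbert_space"
proof (rule complex_eqI)
  have "cinner x x = cnj (cinner x x)" by (rule cinner_commute)
  then show "Im (cinner x x) = Im (complex_of_real ((norm x)\<^sup>2))"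
    by (metis Im_complex_of_real Reals_cnj_iff complex_is_Real_iff)
qed (simp add: Re_cinner power2_norm_eq_inner)

lemma norm_scaleC: "norm (a *\<^sub>C x) = cmod a * norm x" for x :: "'h::complex_hilbert_space"
proof -
  have "complex_of_real ((norm (a *\<^sub>C x))\<^sup>2) = (cnj a * a) * of_real ((norm x)\<^sup>2)"
    unfolding cinner_self[symmetric] cinner_scaleC_left cinner_scaleC_right by simp
  also have "cnj a * a = of_real ((cmod a)\<^sup>2)"
    by (metis complex_norm_square mult.commute)
  finally have "complex_of_real ((norm (a *\<^sub>C x))\<^sup>2) = of_real ((cmod a * norm x)\<^sup>2)"
    by (simp add: power_mult_distrib)
  then have "(norm (a *\<^sub>C x))\<^sup>2 = (cmod a * norm x)\<^sup>2"
    using of_real_eq_iff by blast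
  then show ?thesis by (simp add: power2_eq_iff_nonneg)
qed

lemma Re_mult_cinner_le:
  fixes x y :: "'h::complex_hilbert_space"
  shows "\<bar>Re (c * cinner x y)\<bar> \<le> cmod c * (norm x * norm y)"
proof -
  have "Re (c * cinner x y) = inner x (c *\<^sub>C y)"
    by (simp add: cinner_scaleC_right Re_cinner[symmetric])
  also have "\<bar>\<dots>\<bar> \<le> norm x * norm (c *\<^sub>C y)" by (rule Cauchy_Schwarz_ineq2)
  finally show ?thesis by (simp add: norm_scaleC mult_ac)
qed

text \<open>
  Gram-Schmidt. The bound on the number of basis vectors is what makes the basis usable for families
  of matrices with at most \<open>dim H\<close> columns.
\<close>
lemma complex_orthonormal_basis:
  fixes A :: "'h::complex_hilbert_space set"
  assumes "finite A"
  shows "\<exists>r (e :: nat \<Rightarrow> 'h). enat r \<le> hilbert_dim TYPE('h)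
    \<and> (\<forall>i<r. \<forall>j<r. cinner (e i) (e j) = (if i = j then 1 else 0))
    \<and> (\<forall>x\<in>A. \<exists>c. x = (\<Sum>i<r. c i *\<^sub>C e i))"
proof -
  have "\<exists>r (e :: nat \<Rightarrow> 'h).
      (\<forall>i<r. \<forall>j<r. cinner (e i) (e j) = (if i = j then 1 else 0))
      \<and> (\<forall>x\<in>A. \<exists>c. x = (\<Sum>i<r. c i *\<^sub>C e i))"
    using assms
  proof (induction A)
    case empty
    then show ?case by (intro exI[of _ 0]) auto
  next
    case (insert x A)
    then obtain r and e :: "nat \<Rightarrow> 'h"
      where on: "\<And>i j. i < r \<Longrightarrow> j < r \<Longrightarrow> cinner (e i) (e j) = (if i = j then 1 else 0)"
        and sp: "\<And>y. y \<in> A \<Longrightarrow> \<exists>c. y = (\<Sum>i<r. c i *\<^sub>C e i)" by blast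
    define y where "y = x - (\<Sum>i<r. cinner (e i) x *\<^sub>C e i)"
    have orth: "cinner (e j) y = 0" if "j < r" for j
    proof -
      have "cinner (e j) (\<Sum>i<r. cinner (e i) x *\<^sub>C e i)
          = (\<Sum>i<r. if i = j then cinner (e i) x else 0)"
        unfolding cinner_sum_right cinner_scaleC_right using on that by (intro sum.cong) auto
      then show ?thesis using that by (simp add: y_def cinner_diff_right)
    qed
    show ?case
    proof (cases "y = 0")
      case True
      then have "x = (\<Sum>i<r. cinner (e i) x *\<^sub>C e i)" by (simp add: y_def)
      then have "\<exists>c. x = (\<Sum>i<r. c i *\<^sub>C e i)"
        by (intro exI[of _ "\<lambda>i. cinner (e i) x"])
      then show ?thesis using on sp by blast
    next
      case False
      define f where "f = complex_of_real (1 / norm y) *\<^sub>C y"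
      define e' where "e' = (\<lambda>i. if i < r then e i else f)"
      have f: "cinner (e j) f = 0" "cinner f (e j) = 0" if "j < r" for j
        using orth[OF that] cinner_commute[of y "e j"]
        by (simp_all add: f_def cinner_scaleC_right cinner_scaleC_left)
      have ff: "cinner f f = 1"
        using False unfolding f_def cinner_scaleC_right cinner_scaleC_left
        by (simp add: cinner_self[of y] power2_eq_square)
      have yf: "y = complex_of_real (norm y) *\<^sub>C f"
        using False by (simp add: f_def scaleC_scaleC flip: scaleR_scaleC)
      have ext: "(\<Sum>i<Suc r. (c(r := b)) i *\<^sub>C e' i) = (\<Sum>i<r. c i *\<^sub>C e i) + b *\<^sub>C f" for c b
        by (simp add: e'_def)
      have "cinner (e' i) (e' j) = (if i = j then 1 else 0)" if "i < Suc r" "j < Suc r" for i j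
        using that on f ff by (auto simp: e'_def less_Suc_eq)
      moreover have "\<exists>c. z = (\<Sum>i<Suc r. c i *\<^sub>C e' i)" if z: "z \<in> insert x A" for z
      proof (cases "z = x")
        case True
        have "x = (\<Sum>i<r. cinner (e i) x *\<^sub>C e i) + complex_of_real (norm y) *\<^sub>C f"
          by (subst yf[symmetric]) (simp add: y_def)
        then show ?thesis
          unfolding True ext[symmetric]
          by (intro exI[of _ "(\<lambda>i. cinner (e i) x)(r := complex_of_real (norm y))"])
      next
        case False
        then obtain c where "z = (\<Sum>i<r. c i *\<^sub>C e i)" using sp z by blast
        then have "z = (\<Sum>i<Suc r. (c(r := 0)) i *\<^sub>C e' i)" by (simp only: ext) simp
        then show ?thesis by (intro exI[of _ "c(r := 0)"])
      qed
      ultimately show ?thesis by blast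
    qed
  qed
  then obtain r and e :: "nat \<Rightarrow> 'h"
    where on: "\<And>i j. i < r \<Longrightarrow> j < r \<Longrightarrow> cinner (e i) (e j) = (if i = j then 1 else 0)"
      and sp: "\<forall>y\<in>A. \<exists>c. y = (\<Sum>i<r. c i *\<^sub>C e i)" by blast
  have inj: "inj_on e {..<r}"
    using on by (intro inj_onI) (metis lessThan_iff one_neq_zero)
  have ind: "\<not> complex_vector.dependent (e ` {..<r})"
  proof
    assume "complex_vector.dependent (e ` {..<r})"
    then obtain u v where uv: "v \<in> e ` {..<r}" "u v \<noteq> 0" "(\<Sum>v\<in>e ` {..<r}. u v *\<^sub>C v) = 0"
      using complex_vector.dependent_finite[of "e ` {..<r}"] by auto
    then obtain j where j: "j < r" "v = e j" by auto
    have "0 = cinner (e j) (\<Sum>i<r. u (e i) *\<^sub>C e i)"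
      using uv(3) by (simp add: sum.reindex[OF inj])
    also have "\<dots> = (\<Sum>i<r. if i = j then u (e i) else 0)"
      unfolding cinner_sum_right cinner_scaleC_right using on j by (intro sum.cong) auto
    also have "\<dots> = u v" using j by simp
    finally show False using uv(2) by simp
  qed
  have card: "card (e ` {..<r}) = r" using inj by (simp add: card_image)
  have "enat r \<le> hilbert_dim TYPE('h)"
  proof (cases "\<exists>B :: 'h set. finite B \<and> complex_vector.span B = UNIV")
    case True
    then obtain B :: "'h set" where B: "finite B" "complex_vector.span B = UNIV" by blast
    obtain C where C: "\<not> complex_vector.dependent C"
        "(UNIV :: 'h set) \<subseteq> complex_vector.span C"
        "card C = complex_vector.dim (UNIV :: 'h set)"
      by (rule complex_vector.basis_exists[of "UNIV :: 'h set"]) blast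
    have "finite C"
      using complex_vector.independent_span_bound[OF B(1) C(1)] B(2) by simp
    then have "r \<le> card C"
      using complex_vector.independent_span_bound[OF \<open>finite C\<close> ind subset_trans[OF subset_UNIV C(2)]] card by simp
    then show ?thesis using True C(3) by (simp add: hilbert_dim_def)
  next
    case False
    then show ?thesis unfolding hilbert_dim_def by (simp only: if_False) simp
  qed
  then show ?thesis using on sp by blast
qed

text \<open>
  Working with a real form keeps the construction inside the real Riesz theorem. Invariance of \<open>t\<close> under
  multiplication of both arguments by \<open>\<i>\<close> is exactly what makes the resulting operator complex linear,
  and then its symmetry for the real inner product implies symmetry for the complex one. A bound on
  the diagonal of \<open>t\<close> extends to all of \<open>t\<close> by polarization.
\<close>
lemma bounded_symmetric_form_operator:
  fixes t :: "'h::complex_hilbert_space \<Rightarrow> 'h \<Rightarrow> real"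
  assumes lin: "\<And>x. linear (t x)"
    and sym: "\<And>x y. t x y = t y x"
    and iso: "\<And>x y. t (\<i> *\<^sub>C x) (\<i> *\<^sub>C y) = t x y"
    and bound: "\<And>x. \<bar>t x x\<bar> \<le> C * (norm x)\<^sup>2"
  shows "\<exists>S\<in>herm_ops. \<forall>x y. inner x (S y) = t x y"
proof -
  have add: "t x (y + z) = t x y + t x z" and scale: "t x (c *\<^sub>R y) = c * t x y" for x y z c
    using lin by (auto simp: linear_add linear_scale)
  have add': "t (y + z) x = t y x + t z x" and scale': "t (c *\<^sub>R y) x = c * t y x" for x y z c
    using add[of x y z] scale[of x c y] by (simp_all add: sym)
  have minus': "t (y - z) x = t y x - t z x" and minus: "t x (y - z) = t x y - t x z" for x y z
    using add'[of "y - z" z x] by (simp_all add: sym[of x])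
  have unit: "t x y \<le> C" if "norm x = 1" "norm y = 1" for x y
  proof -
    have "4 * t x y = t (x + y) (x + y) - t (x - y) (x - y)"
      by (simp add: add add' minus minus' sym[of y x])
    also have "\<dots> \<le> C * (norm (x + y))\<^sup>2 + C * (norm (x - y))\<^sup>2"
      using bound[of "x + y"] bound[of "x - y"] by linarith
    also have "\<dots> = C * (2 * (norm x)\<^sup>2 + 2 * (norm y)\<^sup>2)"
      unfolding power2_norm_eq_inner
      by (simp add: inner_add_left inner_add_right inner_diff_left inner_diff_right inner_commute algebra_simps)
    finally show ?thesis using that by simp
  qed
  have zero: "t x 0 = 0" "t 0 x = 0" for x using scale[of x 0 0] scale'[of 0 0 x] by simp_all
  have le: "t x y \<le> C * norm x * norm y" for x y
  proof (cases "x = 0 \<or> y = 0")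
    case False
    then have n: "norm x > 0" "norm y > 0" by auto
    have "t ((1 / norm x) *\<^sub>R x) ((1 / norm y) *\<^sub>R y) \<le> C" by (rule unit) (use n in auto)
    then show ?thesis using n unfolding scale scale' by (simp add: field_simps)
  qed (auto simp: zero)
  have abs: "\<bar>t x y\<bar> \<le> C * norm x * norm y" for x y
    using le[of x y] le[of x "- y"] scale[of x "-1" y] by auto
  have "bounded_linear (t x)" for x
    by (rule bounded_linear_intro[of _ "C * norm x"]) (use add scale abs[of x] in \<open>auto simp: algebra_simps\<close>)
  from Riesz_representation[OF this] have "\<forall>y. \<exists>z. \<forall>x. t y x = inner z x" by blast
  then obtain S where S: "\<And>y x. t y x = inner (S y) x" by metis
  have ext: "u = v" if "\<And>x. inner u x = inner v x" for u v :: 'h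

  proof -
    have "inner (u - v) (u - v) = 0" using that[of "u - v"] by (simp add: inner_diff_left)
    then show ?thesis by simp
  qed
  have Sadd: "S (x + y) = S x + S y" for x y
    by (rule ext) (simp add: inner_add_left flip: S, simp add: add')
  have SscaleR: "S (c *\<^sub>R x) = c *\<^sub>R S x" for x c
    by (rule ext) (simp flip: S, simp add: scale')
  have i_inner: "inner (\<i> *\<^sub>C u) (\<i> *\<^sub>C v) = inner u v" for u v :: 'h
    unfolding Re_cinner[symmetric] by (simp add: cinner_scaleC_left cinner_scaleC_right)
  have i_i: "\<i> *\<^sub>C (- \<i>) *\<^sub>C u = u" for u :: 'h by (simp add: scaleC_scaleC)
  have Si: "S (\<i> *\<^sub>C x) = \<i> *\<^sub>C S x" for x
  proof (rule ext)
    fix y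
    have "inner (S (\<i> *\<^sub>C x)) (\<i> *\<^sub>C (- \<i>) *\<^sub>C y) = inner (\<i> *\<^sub>C S x) (\<i> *\<^sub>C (- \<i>) *\<^sub>C y)"
      unfolding i_inner unfolding S[symmetric] by (rule iso)
    then show "inner (S (\<i> *\<^sub>C x)) y = inner (\<i> *\<^sub>C S x) y" unfolding i_i .
  qed
  have split: "a *\<^sub>C u = Re a *\<^sub>R u + Im a *\<^sub>R (\<i> *\<^sub>C u)" for a and u :: 'h
    by (simp add: scaleR_scaleC scaleC_scaleC mult.commute complex_eq
        flip: complex_vector.scale_left_distrib)
  have SscaleC: "S (a *\<^sub>C x) = a *\<^sub>C S x" for a x
    unfolding split[of a] by (simp add: Sadd SscaleR Si)
  have "norm (S x) \<le> norm x * C" for x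
  proof (cases "S x = 0")
    case True
    have "C * norm x * norm x \<ge> 0" using abs[of x x] by linarith
    then show ?thesis using True by (cases "x = 0") (auto simp: zero_le_mult_iff)
  next
    case False
    have "(norm (S x))\<^sup>2 \<le> C * norm x * norm (S x)"
      using le[of x "S x"] by (simp add: S power2_norm_eq_inner)
    then show ?thesis using False by (simp add: power2_eq_square mult_ac)
  qed
  then have "bounded_linear S"
    by (intro bounded_linear_intro Sadd SscaleR)
  moreover have "cinner (S x) y = cinner x (S y)" for x y
  proof (rule complex_eqI)
    have re: "Re (cinner (S x) y) = Re (cinner x (S y))" for x y
      unfolding Re_cinner by (metis S sym inner_commute)
    show "Re (cinner (S x) y) = Re (cinner x (S y))" by (rule re)
    show "Im (cinner (S x) y) = Im (cinner x (S y))"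
      using re[of x "\<i> *\<^sub>C y"] by (simp add: Si cinner_scaleC_right)
  qed
  ultimately have "S \<in> herm_ops" using SscaleC by (simp add: herm_ops_def bounded_ops_def)
  moreover have "inner x (S y) = t x y" for x y by (metis S sym inner_commute)
  ultimately show ?thesis by blast
qed

section \<open>Forms of operators on a tensor product\<close>

lemma sum_fun_apply: "(\<Sum>i\<in>I. f i) x = (\<Sum>i\<in>I. f i x)"
  for f :: "'i \<Rightarrow> 'a \<Rightarrow> 'b::comm_monoid_add"
  by (induction I rule: infinite_finite_induct) simp_all

lemma mat_adjoint_index:
  assumes "A \<in> carrier_mat d r" "i < r" "j < d"
  shows "mat_adjoint A $$ (i, j) = cnj (A $$ (j, i))"
  using assms by (simp add: mat_adjoint_def mat_of_rows_def)

lemma mat_adjoint_carrier: "A \<in> carrier_mat d r \<Longrightarrow> mat_adjoint A \<in> carrier_mat r d"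
  by (auto simp: mat_adjoint_def mat_of_rows_def)

lemma herm_mat_index: "A \<in> herm_mat d \<Longrightarrow> i < d \<Longrightarrow> j < d \<Longrightarrow> A $$ (i, j) = cnj (A $$ (j, i))"
  using mat_adjoint_index[of A d d i j] by (simp add: herm_mat_def)

text \<open>
  The value \<open>\<langle>v, (P \<otimes> S) v\<rangle>\<close>. The Hilbert space may be \<open>\<complex>\<close> itself: with \<open>S = id\<close> and a tuple \<open>z\<close> of
  numbers this is \<open>z\<^sup>* P z\<close>, so that scalar matrices and operators obey the same rules.
\<close>
definition op_form ::
    "nat \<Rightarrow> complex mat \<Rightarrow> ('h::complex_hilbert_space \<Rightarrow> 'h) \<Rightarrow> (nat \<Rightarrow> 'h) \<Rightarrow> complex" where
  "op_form d P S v = (\<Sum>a<d. \<Sum>b<d. P $$ (a, b) * cinner (v a) (S (v b)))"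

text \<open>
  The operator \<open>W \<otimes> 1\<close> applied to \<open>x\<close>.
\<close>
definition mat_tuple :: "nat \<Rightarrow> complex mat \<Rightarrow> (nat \<Rightarrow> 'h::complex_hilbert_space) \<Rightarrow> nat \<Rightarrow> 'h" where
  "mat_tuple r W x = (\<lambda>a. if a < dim_row W then \<Sum>c<r. W $$ (a, c) *\<^sub>C x c else 0)"

lemma op_form_cong:
  assumes "\<And>a. a < d \<Longrightarrow> v a = v' a"
  shows "op_form d P S v = op_form d P S v'"
  unfolding op_form_def using assms by (intro sum.cong) auto

lemma tensor_cinner_tensor_op:
  assumes "P \<in> carrier_mat d d"
  shows "tensor_cinner d v (tensor_op P S v) = op_form d P S v"
  using assms
  by (auto simp: tensor_cinner_def tensor_op_def op_form_def cinner_sum_right cinner_scaleC_right)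

lemma op_form_mat_sum:
  "op_form r (mat_sum r r F I) S x = (\<Sum>i\<in>I. op_form r (F i) S x)"
proof -
  have "op_form r (mat_sum r r F I) S x
      = (\<Sum>a<r. \<Sum>b<r. \<Sum>i\<in>I. F i $$ (a, b) * cinner (x a) (S (x b)))"
    unfolding op_form_def mat_sum_def by (intro sum.cong refl) (simp add: sum_distrib_right)
  also have "\<dots> = (\<Sum>a<r. \<Sum>i\<in>I. \<Sum>b<r. F i $$ (a, b) * cinner (x a) (S (x b)))"
    by (intro sum.cong refl sum.swap)
  also have "\<dots> = (\<Sum>i\<in>I. op_form r (F i) S x)"
    unfolding op_form_def by (rule sum.swap)
  finally show ?thesis .
qed

lemma bounded_ops_sum:
  assumes "S \<in> bounded_ops"
  shows "S (\<Sum>i\<in>I. c i *\<^sub>C x i) = (\<Sum>i\<in>I. c i *\<^sub>C S (x i))"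
proof -
  have l: "linear S" and s: "\<And>a x. S (a *\<^sub>C x) = a *\<^sub>C S x"
    using assms by (auto simp: bounded_ops_def bounded_linear.linear)
  show ?thesis unfolding linear_sum[OF l] s ..
qed

lemma mult_mat_index:
  assumes "A \<in> carrier_mat k l" "B \<in> carrier_mat l m" "i < k" "j < m"
  shows "(A * B) $$ (i, j) = (\<Sum>b<l. A $$ (i, b) * B $$ (b, j))"
  using assms by (auto simp: scalar_prod_def atLeast0LessThan intro!: sum.cong)

lemma compress_index:
  assumes W: "W \<in> carrier_mat d r" and P: "P \<in> carrier_mat d d" and c: "c < r" "c' < r"
  shows "(mat_adjoint W * P * W) $$ (c, c')
    = (\<Sum>a<d. \<Sum>b<d. cnj (W $$ (a, c)) * P $$ (a, b) * W $$ (b, c'))"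
proof -
  note Wa = mat_adjoint_carrier[OF W]
  have "(mat_adjoint W * P) $$ (c, b) = (\<Sum>a<d. cnj (W $$ (a, c)) * P $$ (a, b))" if "b < d" for b
    using mat_adjoint_index[OF W c(1)] by (simp add: mult_mat_index[OF Wa P c(1) that])
  then have "(mat_adjoint W * P * W) $$ (c, c')
      = (\<Sum>b<d. (\<Sum>a<d. cnj (W $$ (a, c)) * P $$ (a, b)) * W $$ (b, c'))"
    unfolding mult_mat_index[OF mult_carrier_mat[OF Wa P] W c] by simp
  also have "\<dots> = (\<Sum>b<d. \<Sum>a<d. cnj (W $$ (a, c)) * P $$ (a, b) * W $$ (b, c'))"
    by (simp add: sum_distrib_right)
  finally show ?thesis by (subst sum.swap)
qed

lemma op_form_compress:
  assumes W: "W \<in> carrier_mat d r" and P: "P \<in> carrier_mat d d" and S: "S \<in> bounded_ops"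
  shows "op_form r (mat_adjoint W * P * W) S x = op_form d P S (mat_tuple r W x)"
proof -
  let ?f = "\<lambda>a b c c'. cnj (W $$ (a, c)) * P $$ (a, b) * W $$ (b, c') * cinner (x c) (S (x c'))"
  have "op_form r (mat_adjoint W * P * W) S x = (\<Sum>c<r. \<Sum>c'<r. \<Sum>a<d. \<Sum>b<d. ?f a b c c')"
    unfolding op_form_def
    by (intro sum.cong refl) (simp add: compress_index[OF W P] sum_distrib_right)
  also have "\<dots> = (\<Sum>c<r. \<Sum>a<d. \<Sum>c'<r. \<Sum>b<d. ?f a b c c')"
    by (intro sum.cong refl sum.swap)
  also have "\<dots> = (\<Sum>a<d. \<Sum>c<r. \<Sum>b<d. \<Sum>c'<r. ?f a b c c')"
    by (subst sum.swap) (intro sum.cong refl sum.swap)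
  also have "\<dots> = (\<Sum>a<d. \<Sum>b<d. \<Sum>c<r. \<Sum>c'<r. ?f a b c c')"
    by (intro sum.cong refl sum.swap)
  also have "\<dots> = op_form d P S (mat_tuple r W x)"
    unfolding op_form_def
  proof (intro sum.cong refl)
    fix a b assume "a \<in> {..<d}" "b \<in> {..<d}"
    then have "cinner (mat_tuple r W x a) (S (mat_tuple r W x b))
        = (\<Sum>c<r. \<Sum>c'<r. cnj (W $$ (a, c)) * (W $$ (b, c') * cinner (x c) (S (x c'))))"
      using W unfolding mat_tuple_def
      by (simp add: bounded_ops_sum[OF S] cinner_sum_left)
        (simp add: cinner_sum_right cinner_scaleC_left cinner_scaleC_right sum_distrib_left
          mult.left_commute)
    then show "(\<Sum>c<r. \<Sum>c'<r. ?f a b c c')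
        = P $$ (a, b) * cinner (mat_tuple r W x a) (S (mat_tuple r W x b))"
      by (simp add: sum_distrib_left mult_ac)
  qed
  finally show ?thesis .
qed

lemma op_form_herm_real:
  assumes P: "P \<in> herm_mat d" and S: "S \<in> herm_ops"
  shows "Im (op_form d P S v) = 0"
proof -
  have "cnj (cinner (v a) (S (v b))) = cinner (v b) (S (v a))" for a b
    using S cinner_commute[of "S (v b)" "v a"] cinner_commute[of "v a" "S (v b)"]
    by (auto simp: herm_ops_def)
  then have "cnj (op_form d P S v) = (\<Sum>a<d. \<Sum>b<d. P $$ (b, a) * cinner (v b) (S (v a)))"
    unfolding op_form_def by (auto simp: herm_mat_index[OF P, symmetric] intro!: sum.cong)
  also have "\<dots> = op_form d P S v" unfolding op_form_def by (rule sum.swap)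
  finally show ?thesis by (metis Reals_cnj_iff complex_is_Real_iff)
qed

lemma id_bounded_ops: "id \<in> bounded_ops"
  by (auto simp: bounded_ops_def bounded_linear_ident id_def)

lemma id_herm_ops: "id \<in> herm_ops"
  by (auto simp: herm_ops_def id_bounded_ops)

lemma finite_nc_support: "finite (nc_support p)"
  unfolding nc_support_def elements_mat_def by auto

lemma nc_coeff_outside_support:
  assumes "p \<in> carrier_mat d d" "w \<notin> nc_support p" "a < d" "b < d"
  shows "nc_coeff p w $$ (a, b) = 0"
  using assms by (auto simp: nc_coeff_def nc_support_def elements_mat_def in_keys_iff)

text \<open>
  Summation over any finite superset of the support allows two matrices of polynomials with different
  supports to be compared term by term; compression by \<open>W\<close> can make the support smaller.
\<close>
lemma tensor_cinner_nc_eval: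
  assumes p: "p \<in> carrier_mat d d" and A: "finite A" "nc_support p \<subseteq> A"
  shows "tensor_cinner d v (nc_eval p T v)
    = (\<Sum>w\<in>A. op_form d (nc_coeff p w) (word_eval T w) v)"
proof -
  have "tensor_cinner d v (nc_eval p T v)
      = (\<Sum>w\<in>nc_support p. tensor_cinner d v (tensor_op (nc_coeff p w) (word_eval T w) v))"
    unfolding tensor_cinner_def nc_eval_def sum_fun_apply cinner_sum_right by (rule sum.swap)
  also have "\<dots> = (\<Sum>w\<in>nc_support p. op_form d (nc_coeff p w) (word_eval T w) v)"
    using p by (intro sum.cong refl tensor_cinner_tensor_op) (auto simp: nc_coeff_def)
  also have "\<dots> = (\<Sum>w\<in>A. op_form d (nc_coeff p w) (word_eval T w) v)"
    using A nc_coeff_outside_support[OF p] by (intro sum.mono_neutral_left) (auto simp: op_form_def)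
  finally show ?thesis .
qed

lemma word_eval_Cons: "word_eval T (Word (i # l)) = T i \<circ> word_eval T (Word l)"
  by (simp add: word_eval_def)

lemma word_eval_snoc: "word_eval T (Word (l @ [i])) = word_eval T (Word l) \<circ> T i"
  by (induction l) (simp_all add: word_eval_def comp_assoc)

lemma bounded_ops_comp: "S \<in> bounded_ops \<Longrightarrow> S' \<in> bounded_ops \<Longrightarrow> S \<circ> S' \<in> bounded_ops"
  by (auto simp: bounded_ops_def bounded_linear_compose comp_def)

lemma word_eval_herm:
  fixes T :: "nat \<Rightarrow> 'h::complex_hilbert_space \<Rightarrow> 'h"
  assumes T: "\<forall>i\<in>{1..n}. T i \<in> herm_ops" and w: "w \<in> words n"
  shows word_eval_bounded: "word_eval T w \<in> bounded_ops"
    and word_eval_adjoint: "cinner (word_eval T w x) y = cinner x (word_eval T (word_rev w) y)"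
proof -
  have "word_eval T (Word l) \<in> bounded_ops \<and>
      (\<forall>x y. cinner (word_eval T (Word l) x) y = cinner x (word_eval T (Word (rev l)) y))"
    if "set l \<subseteq> {1..n}" for l
    using that
  proof (induction l)
    case Nil
    then show ?case using id_bounded_ops[unfolded id_def] by (simp add: word_eval_def id_def)
  next
    case (Cons i l)
    then have "T i \<in> herm_ops" using T by simp
    then show ?case
      using Cons by (auto simp: word_eval_Cons word_eval_snoc herm_ops_def
          intro: bounded_ops_comp[unfolded comp_def])
  qed
  then show "word_eval T w \<in> bounded_ops"
      "cinner (word_eval T w x) y = cinner x (word_eval T (word_rev w) y)"
    using w by (cases w; simp add: words_def word_rev_def)+
qed

lemma nc_support_words: "p \<in> nc_herm_mat d n \<Longrightarrow> nc_support p \<subseteq> words n"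
  by (auto simp: nc_herm_mat_def nc_mat_def nc_support_def free_algebra_def)

lemma nc_eval_compress:
  fixes T :: "nat \<Rightarrow> 'h::complex_hilbert_space \<Rightarrow> 'h"
  assumes p: "p \<in> nc_herm_mat d n" and T: "\<forall>i\<in>{1..n}. T i \<in> herm_ops"
    and W: "W \<in> carrier_mat d r"
  shows "tensor_cinner r x (nc_eval (nc_compress W p) T x)
    = tensor_cinner d (mat_tuple r W x) (nc_eval p T (mat_tuple r W x))"
proof -
  have pc: "p \<in> carrier_mat d d" using p by (simp add: nc_herm_mat_def nc_mat_def)
  let ?q = "nc_compress W p" and ?A = "nc_support p"
  have q: "?q \<in> carrier_mat r r" using W by (simp add: nc_compress_def)
  have coeff: "nc_coeff ?q w $$ (a, b)
      = (if w \<in> ?A then (mat_adjoint W * nc_coeff p w * W) $$ (a, b) else 0)" if "a < r" "b < r" for a b w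
    using W that
    by (simp add: nc_coeff_def nc_compress_def lookup_sum lookup_single when_def finite_nc_support)
  have "nc_support ?q \<subseteq> ?A"
  proof
    fix w assume "w \<in> nc_support ?q"
    then obtain a b where "a < r" "b < r" "nc_coeff ?q w $$ (a, b) \<noteq> 0"
      using q by (auto simp: nc_support_def elements_mat_def in_keys_iff nc_coeff_def)
    then show "w \<in> ?A" using coeff[of a b w] by (auto split: if_splits)
  qed
  then have "tensor_cinner r x (nc_eval ?q T x)
      = (\<Sum>w\<in>?A. op_form r (nc_coeff ?q w) (word_eval T w) x)"
    by (intro tensor_cinner_nc_eval q finite_nc_support)
  also have "\<dots> = (\<Sum>w\<in>?A. op_form r (mat_adjoint W * nc_coeff p w * W) (word_eval T w) x)"
    unfolding op_form_def by (intro sum.cong refl) (simp add: coeff)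
  also have "\<dots> = (\<Sum>w\<in>?A. op_form d (nc_coeff p w) (word_eval T w) (mat_tuple r W x))"
    using pc nc_support_words[OF p] word_eval_bounded[OF T]
    by (intro sum.cong refl op_form_compress W) (auto simp: nc_coeff_def)
  also have "\<dots> = tensor_cinner d (mat_tuple r W x) (nc_eval p T (mat_tuple r W x))"
    by (rule tensor_cinner_nc_eval[OF pc finite_nc_support, symmetric]) simp
  finally show ?thesis .
qed

text \<open>
  Conjugation exchanges the term of the word \<open>w\<close> with that of the reversed word: \<open>p = p\<^sup>*\<close> relates the
  coefficients and \<open>T\<^sub>i = T\<^sub>i\<^sup>*\<close> the evaluations.
\<close>
lemma nc_eval_herm_real:
  fixes T :: "nat \<Rightarrow> 'h::complex_hilbert_space \<Rightarrow> 'h"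
  assumes p: "p \<in> nc_herm_mat d n" and T: "\<forall>i\<in>{1..n}. T i \<in> herm_ops"
  shows "Im (tensor_cinner d v (nc_eval p T v)) = 0"
proof -
  have pc: "p \<in> carrier_mat d d" and star: "nc_mat_star p = p"
    using p by (auto simp: nc_herm_mat_def nc_mat_def)
  let ?A = "nc_support p"
  have star_index: "p $$ (a, b) = nc_star (p $$ (b, a))" if "a < d" "b < d" for a b
  proof -
    have "nc_mat_star p $$ (a, b) = nc_star (p $$ (b, a))"
      using that pc by (simp add: nc_mat_star_def)
    then show ?thesis unfolding star .
  qed
  have coeff: "cnj (nc_coeff p w $$ (a, b)) = nc_coeff p (word_rev w) $$ (b, a)"
    if "a < d" "b < d" for a b w
    using that pc star_index[of b a] by (simp add: nc_coeff_def nc_star.rep_eq word_rev_def)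
  have rev: "word_rev w \<in> ?A" if w: "w \<in> ?A" for w
  proof (rule ccontr)
    assume n: "word_rev w \<notin> ?A"
    obtain a b where "a < d" "b < d" "nc_coeff p w $$ (a, b) \<noteq> 0"
      using w pc by (auto simp: nc_support_def elements_mat_def in_keys_iff nc_coeff_def)
    then show False using coeff[of a b w] nc_coeff_outside_support[OF pc n, of b a] by simp
  qed
  let ?F = "\<lambda>w. op_form d (nc_coeff p w) (word_eval T w) v"
  have cnj: "cnj (?F w) = ?F (word_rev w)" if "w \<in> ?A" for w
  proof -
    have w: "w \<in> words n" using that nc_support_words[OF p] by blast
    have "cnj (cinner (v a) (word_eval T w (v b))) = cinner (v b) (word_eval T (word_rev w) (v a))" for a b
      using word_eval_adjoint[OF T w, of "v b" "v a"] cinner_commute[of "word_eval T w (v b)" "v a"]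
      by simp
    then have "cnj (?F w) = (\<Sum>a<d. \<Sum>b<d. nc_coeff p (word_rev w) $$ (b, a)
        * cinner (v b) (word_eval T (word_rev w) (v a)))"
      unfolding op_form_def by (simp add: coeff)
    also have "\<dots> = ?F (word_rev w)" unfolding op_form_def by (rule sum.swap)
    finally show ?thesis .
  qed
  have "cnj (\<Sum>w\<in>?A. ?F w) = (\<Sum>w\<in>?A. ?F (word_rev w))" by (simp add: cnj)
  also have "\<dots> = (\<Sum>w\<in>?A. ?F w)"
    by (rule sum.reindex_bij_witness[of _ word_rev word_rev])
      (auto simp: rev, auto simp: word_rev_def)
  finally show ?thesis
    unfolding tensor_cinner_nc_eval[OF pc finite_nc_support subset_refl]
    by (metis Reals_cnj_iff complex_is_Real_iff)
qed

section \<open>Cones of moments\<close>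

text \<open>
  If positive multiples of values of \<open>f\<close> are values of \<open>f\<close>, as for quadratic maps, this is the convex
  cone generated by the range of \<open>f\<close>. Lists make concatenation the addition of the cone.
\<close>
definition sum_cone :: "('b \<Rightarrow> 'a::comm_monoid_add) \<Rightarrow> 'a set" where
  "sum_cone f = {sum_list (map f xs) | xs. True}"

lemma sum_cone_zero: "0 \<in> sum_cone f"
  by (auto simp: sum_cone_def intro: exI[of _ "[]"])

lemma sum_cone_mem: "f x \<in> sum_cone f"
  by (auto simp: sum_cone_def intro: exI[of _ "[x]"])

lemma sum_cone_add:
  assumes "x \<in> sum_cone f" "y \<in> sum_cone f"
  shows "x + y \<in> sum_cone f"
proof -
  from assms obtain xs ys where "x = sum_list (map f xs)" "y = sum_list (map f ys)"
    by (auto simp: sum_cone_def)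
  then have "x + y = sum_list (map f (xs @ ys))" by simp
  then show ?thesis unfolding sum_cone_def by blast
qed

lemma sum_list_map_scaleR:
  fixes f :: "'b \<Rightarrow> 'a::real_vector"
  shows "sum_list (map (\<lambda>x. c *\<^sub>R f x) xs) = c *\<^sub>R sum_list (map f xs)"
  by (induction xs) (simp_all add: scaleR_add_right)

lemma sum_cone_scale:
  fixes f :: "'b \<Rightarrow> 'a::real_vector"
  assumes "x \<in> sum_cone f" and h: "\<And>y. f (h y) = c *\<^sub>R f y"
  shows "c *\<^sub>R x \<in> sum_cone f"
proof -
  from assms obtain xs where "x = sum_list (map f xs)" by (auto simp: sum_cone_def)
  then have "c *\<^sub>R x = sum_list (map f (map h xs))"
    by (simp add: comp_def h sum_list_map_scaleR)
  then show ?thesis unfolding sum_cone_def by blast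
qed

lemma sum_cone_induct [consumes 1, case_names zero add]:
  assumes "x \<in> sum_cone f" "P 0" "\<And>y x. x \<in> sum_cone f \<Longrightarrow> P x \<Longrightarrow> P (f y + x)"
  shows "P x"
proof -
  from assms(1) obtain xs where x: "x = sum_list (map f xs)" by (auto simp: sum_cone_def)
  show ?thesis unfolding x
  proof (induction xs)
    case (Cons y xs)
    have "sum_list (map f xs) \<in> sum_cone f" unfolding sum_cone_def by blast
    from assms(3)[OF this Cons.IH] show ?case by simp
  qed (simp add: assms(2))
qed

text \<open>
  The point \<open>(z\<^sup>* B\<^sub>i z)\<^sub>i\<close> of \<open>\<real>\<^sup>m\<close>, extended by zero.
\<close>
definition form_vec :: "nat \<Rightarrow> nat \<Rightarrow> (nat \<Rightarrow> complex mat) \<Rightarrow> (nat \<Rightarrow> complex) \<Rightarrow> nat \<Rightarrow> real" where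
  "form_vec d m B z = (\<lambda>i. if i \<in> {1..m} then Re (op_form d (B i) id z) else 0)"

text \<open>
  The operators \<open>M\<^sub>i(v)\<close> of the introduction, each encoded by its quadratic form \<open>u \<mapsto> \<langle>u, M\<^sub>i(v) u\<rangle>\<close>, which
  determines it. With the entries \<open>z\<^sub>a = \<langle>u, v\<^sub>a\<rangle>\<close> the value of this form is \<open>z\<^sup>* B\<^sub>i z\<close>, so for every \<open>u\<close> it
  lies in the range of \<open>form_vec\<close>.
\<close>
definition moment ::
    "nat \<Rightarrow> nat \<Rightarrow> (nat \<Rightarrow> complex mat) \<Rightarrow> (nat \<Rightarrow> 'h::complex_hilbert_space) \<Rightarrow> 'h \<Rightarrow> nat \<Rightarrow> real" where
  "moment d m B v = (\<lambda>u. form_vec d m B (\<lambda>a. cinner u (v a)))"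

lemma form_vec_cong: "(\<And>a. a < d \<Longrightarrow> z a = z' a) \<Longrightarrow> form_vec d m B z = form_vec d m B z'"
  unfolding form_vec_def using op_form_cong[of d z z'] by (intro ext) simp

lemma form_vec_scale: "form_vec d m B (\<lambda>a. k * z a) = (cmod k)\<^sup>2 *\<^sub>R form_vec d m B z"
proof -
  have "op_form d P id (\<lambda>a. k * z a) = of_real ((cmod k)\<^sup>2) * op_form d P id z" for P
    unfolding op_form_def complex_norm_square
    by (simp add: cinner_complex_def sum_distrib_left mult_ac)
  then show ?thesis by (auto simp: form_vec_def scaleR_fun_def)
qed

lemma form_vec_parallelogram:
  "form_vec d m B (\<lambda>a. x a + y a) + form_vec d m B (\<lambda>a. x a - y a)
    = 2 *\<^sub>R form_vec d m B x + 2 *\<^sub>R form_vec d m B y"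
proof -
  have "op_form d P id (\<lambda>a. x a + y a) + op_form d P id (\<lambda>a. x a - y a)
      = 2 * op_form d P id x + 2 * op_form d P id y" for P
    unfolding op_form_def sum.distrib[symmetric] sum_distrib_left
    by (intro sum.cong refl) (simp add: cinner_complex_def algebra_simps)
  from this[THEN arg_cong[of _ _ Re]] show ?thesis
    by (auto simp: form_vec_def scaleR_fun_def)
qed

lemma op_form_psd:
  assumes M: "M \<in> herm_mat d" and pos: "\<And>z :: nat \<Rightarrow> complex. 0 \<le> Re (op_form d M id z)"
  shows "mat_psd d M"
proof -
  have Mc: "M \<in> carrier_mat d d" using M by (simp add: herm_mat_def)
  have "(M *\<^sub>v v) \<bullet>c v = op_form d M id (\<lambda>a. v $ a)" if "v \<in> carrier_vec d" for v
    using that Mc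
    by (auto simp: scalar_prod_def op_form_def cinner_complex_def atLeast0LessThan sum_distrib_left
        sum_distrib_right mult_ac intro!: sum.cong)
  then show ?thesis
    using M pos op_form_herm_real[OF M id_herm_ops]
    by (auto simp: mat_psd_def less_eq_complex_def)
qed

lemma fun_expand_delta:
  fixes x :: "nat \<Rightarrow> real"
  assumes "\<And>i. i \<notin> I \<Longrightarrow> x i = 0" "finite I"
  shows "x = (\<Sum>i\<in>I. x i *\<^sub>R (\<lambda>j. if j = i then 1 else 0))"
proof
  fix j
  have "(\<Sum>i\<in>I. x i *\<^sub>R (\<lambda>j. if j = i then 1 else 0)) j = (\<Sum>i\<in>I. if i = j then x i else 0)"
    unfolding sum_fun_apply by (intro sum.cong) (auto simp: scaleR_fun_def)
  also have "\<dots> = x j" using assms by simp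
  finally show "x j = (\<Sum>i\<in>I. x i *\<^sub>R (\<lambda>j. if j = i then 1 else 0)) j" ..
qed

lemma sum_cone_form_vec_outside:
  assumes "x \<in> sum_cone (form_vec d m B)" "i \<notin> {1..m}"
  shows "x i = 0"
  using assms by (induction rule: sum_cone_induct) (auto simp: form_vec_def)

text \<open>
  A functional on \<open>\<real>\<^sup>m\<close> with coordinates \<open>s\<^sub>i\<close> has the value \<open>z\<^sup>* (\<Sum>\<^sub>i s\<^sub>i B\<^sub>i) z\<close> at \<open>form_vec d m B z\<close>. If it
  is nonnegative on the cone, then \<open>\<Sum>\<^sub>i s\<^sub>i B\<^sub>i\<close> is positive semidefinite and, by indefiniteness, zero, so
  the functional vanishes on the cone. The \<open>B\<^sub>i\<close> may be linearly dependent; then the cone is a proper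
  subspace.
\<close>
lemma form_vec_cone_symmetric:
  assumes B: "\<forall>i\<in>{1..m}. B i \<in> herm_mat d"
    and indef: "indefinite_subspace d (real_span d m B)"
    and x: "x \<in> sum_cone (form_vec d m B)"
  shows "- x \<in> sum_cone (form_vec d m B)"
proof -
  let ?K = "sum_cone (form_vec d m B)"
  let ?\<delta> = "\<lambda>i j. if j = i then 1 else 0 :: real"
  show ?thesis
  proof (rule finite_dim_cone_symmetric[where K = ?K and D = "?\<delta> ` {1..m}"])
    show "0 \<in> ?K" "x \<in> ?K" by (rule sum_cone_zero x)+
    show "y + z \<in> ?K" if "y \<in> ?K" "z \<in> ?K" for y z by (rule sum_cone_add[OF that])
    show "c *\<^sub>R y \<in> ?K" if "c > 0" "y \<in> ?K" for c y
      by (rule sum_cone_scale[OF that(2), of "\<lambda>z a. of_real (sqrt c) * z a"])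
        (use that(1) in \<open>simp add: form_vec_scale\<close>)
    show "finite (?\<delta> ` {1..m})" by simp
    show "?K \<subseteq> real_vector.span (?\<delta> ` {1..m})"
    proof
      fix y assume "y \<in> ?K"
      then have "y = (\<Sum>i\<in>{1..m}. y i *\<^sub>R ?\<delta> i)"
        by (intro fun_expand_delta sum_cone_form_vec_outside) auto
      also have "\<dots> \<in> real_vector.span (?\<delta> ` {1..m})"
        by (intro real_vector.span_sum real_vector.span_scale real_vector.span_base) auto
      finally show "y \<in> real_vector.span (?\<delta> ` {1..m})" .
    qed
  next
    fix \<phi> :: "(nat \<Rightarrow> real) \<Rightarrow> real" and y
    assume lin: "linear \<phi>" and pos: "\<And>x. x \<in> ?K \<Longrightarrow> 0 \<le> \<phi> x" and y: "y \<in> ?K"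
    define M where "M = mat_sum d d (\<lambda>i. complex_of_real (\<phi> (?\<delta> i)) \<cdot>\<^sub>m B i) {1..m}"
    have smult: "op_form d (c \<cdot>\<^sub>m B i) id z = c * op_form d (B i) id z"
      if "B i \<in> carrier_mat d d" for c i and z :: "nat \<Rightarrow> complex"
      using that by (simp add: op_form_def sum_distrib_left mult_ac)
    have MS: "M \<in> real_span d m B" unfolding real_span_def M_def
      by (intro CollectI exI[of _ "\<lambda>i. \<phi> (?\<delta> i)"]) simp
    have sub: "real_span d m B \<subseteq> herm_mat d"
      using indef by (simp add: indefinite_subspace_def real_subspace_def)
    have Mh: "M \<in> herm_mat d" using MS sub by blast
    have form: "\<phi> (form_vec d m B z) = Re (op_form d M id z)" for z
    proof -
      have "form_vec d m B z = (\<Sum>i\<in>{1..m}. form_vec d m B z i *\<^sub>R ?\<delta> i)"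
        by (intro fun_expand_delta) (auto simp: form_vec_def)
      from arg_cong[OF this, of \<phi>]
      have "\<phi> (form_vec d m B z) = (\<Sum>i\<in>{1..m}. form_vec d m B z i * \<phi> (?\<delta> i))"
        by (simp only: linear_sum[OF lin] linear_scale[OF lin] real_scaleR_def)
      also have "\<dots> = (\<Sum>i\<in>{1..m}. \<phi> (?\<delta> i) * Re (op_form d (B i) id z))"
        by (intro sum.cong) (auto simp: form_vec_def)
      also have "\<dots> = Re (op_form d M id z)"
        unfolding M_def op_form_mat_sum Re_sum
        using B by (intro sum.cong refl) (auto simp: smult herm_mat_def)
      finally show ?thesis .
    qed
    have "mat_psd d M"
      by (rule op_form_psd[OF Mh]) (use form pos sum_cone_mem in metis)
    then have "M = 0\<^sub>m d d"
      using indef MS by (auto simp: indefinite_subspace_def mat_indefinite_def)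
    then have zero: "\<phi> (form_vec d m B z) = 0" for z by (simp add: form op_form_def)
    show "\<phi> y = 0"
      using y
      by (induction rule: sum_cone_induct)
        (simp_all only: linear_0[OF lin] linear_add[OF lin] zero add_0)
  qed
qed

lemma moment_cong:
  assumes "\<And>a. a < d \<Longrightarrow> v a = v' a"
  shows "moment d m B v = moment d m B v'"
  unfolding moment_def using assms by (intro ext fun_cong[OF form_vec_cong]) auto

lemma moment_scaleR:
  "moment d m B (\<lambda>a. c *\<^sub>R v a) = c\<^sup>2 *\<^sub>R moment d m B v"
  unfolding moment_def cinner_scaleR_right form_vec_scale by (simp add: scaleR_fun_def)

lemma moment_parallelogram:
  "moment d m B (\<lambda>a. x a + y a) + moment d m B (\<lambda>a. x a - y a)
    = 2 *\<^sub>R moment d m B x + 2 *\<^sub>R moment d m B y"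
proof
  fix u
  show "(moment d m B (\<lambda>a. x a + y a) + moment d m B (\<lambda>a. x a - y a)) u
    = (2 *\<^sub>R moment d m B x + 2 *\<^sub>R moment d m B y) u"
    using form_vec_parallelogram[of d m B "\<lambda>a. cinner u (x a)" "\<lambda>a. cinner u (y a)"]
    by (simp add: moment_def cinner_add_right cinner_diff_right scaleR_fun_def)
qed

text \<open>
  The moment of \<open>z \<otimes> x\<close> is \<open>form_vec d m B z \<otimes> |x\<rangle>\<langle>x|\<close>.
\<close>
lemma moment_elementary_tensor:
  "moment d m B (\<lambda>a. z a *\<^sub>C x) = (\<lambda>u. (cmod (cinner u x))\<^sup>2 *\<^sub>R form_vec d m B z)"
proof -
  have "(\<lambda>a. cinner u (z a *\<^sub>C x)) = (\<lambda>a. cinner u x * z a)" for u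
    by (simp add: cinner_scaleC_right mult.commute)
  then show ?thesis unfolding moment_def form_vec_scale[symmetric] by simp
qed

lemma elementary_tensor_mem_moment_cone:
  assumes "k \<in> sum_cone (form_vec d m B)"
  shows "(\<lambda>u. (cmod (cinner u x))\<^sup>2 *\<^sub>R k) \<in> sum_cone (moment d m B)"
  using assms
proof (induction rule: sum_cone_induct)
  case zero
  then show ?case using sum_cone_zero[of "moment d m B"] by (simp add: zero_fun_def scaleR_fun_def)
next
  case (add z k)
  have "(\<lambda>u. (cmod (cinner u x))\<^sup>2 *\<^sub>R (form_vec d m B z + k))
      = moment d m B (\<lambda>a. z a *\<^sub>C x) + (\<lambda>u. (cmod (cinner u x))\<^sup>2 *\<^sub>R k)"
    unfolding moment_elementary_tensor by (auto simp: scaleR_add_right)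
  then show ?case using sum_cone_add[OF sum_cone_mem add(2)] by metis
qed

text \<open>
  For an elementary tensor \<open>z \<otimes> x\<close> the claim reduces to the cone in \<open>\<real>\<^sup>m\<close>. Every tuple is a sum of \<open>d\<close>
  elementary tensors, and the parallelogram law in the form
  \<open>- M(x + y) = M(x - y) + 2 (- M(x)) + 2 (- M(y))\<close> shows that tuples with \<open>- M(v)\<close> in the cone are closed
  under sums.
\<close>
lemma moment_cone_symmetric:
  fixes x :: "'h::complex_hilbert_space \<Rightarrow> nat \<Rightarrow> real"
  assumes K: "\<And>k. k \<in> sum_cone (form_vec d m B) \<Longrightarrow> - k \<in> sum_cone (form_vec d m B)"
    and x: "x \<in> sum_cone (moment d m B)"
  shows "- x \<in> sum_cone (moment d m B)"
proof -
  let ?E = "sum_cone (moment d m B) :: ('h \<Rightarrow> nat \<Rightarrow> real) set"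
  have double: "2 *\<^sub>R y \<in> ?E" if "y \<in> ?E" for y
    using sum_cone_add[OF that that] by (simp add: scaleR_2)
  have elem: "- moment d m B (\<lambda>a. z a *\<^sub>C h) \<in> ?E" for z and h :: 'h
  proof -
    have "- moment d m B (\<lambda>a. z a *\<^sub>C h)
        = (\<lambda>u. (cmod (cinner u h))\<^sup>2 *\<^sub>R (- form_vec d m B z))"
      unfolding moment_elementary_tensor by (auto simp: fun_eq_iff)
    then show ?thesis
      using elementary_tensor_mem_moment_cone[OF K[OF sum_cone_mem]] by metis
  qed
  have neg: "- moment d m B v \<in> ?E" for v
  proof -
    have "- moment d m B (\<lambda>a. if a < n then v a else 0) \<in> ?E" for n
    proof (induction n)
      case 0
      have "moment d m B (\<lambda>a. 0 :: 'h) = 0"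
        using moment_scaleR[of d m B 0 v] by simp
      then have "- moment d m B (\<lambda>a. if a < 0 then v a else 0) = 0" by simp
      then show ?case using sum_cone_zero by metis
    next
      case (Suc n)
      let ?x = "\<lambda>a. if a < n then v a else 0"
      let ?y = "\<lambda>a. (if a = n then 1 else 0) *\<^sub>C v n"
      have e: "(\<lambda>a. if a < Suc n then v a else 0) = (\<lambda>a. ?x a + ?y a)"
        by (auto simp: less_Suc_eq)
      have "- moment d m B (\<lambda>a. ?x a + ?y a)
          = moment d m B (\<lambda>a. ?x a - ?y a)
            + (2 *\<^sub>R (- moment d m B ?x) + 2 *\<^sub>R (- moment d m B ?y))"
        using moment_parallelogram[of d m B ?x ?y] by (simp add: algebra_simps)
      also have "\<dots> \<in> ?E"
        by (intro sum_cone_add sum_cone_mem double elem Suc.IH)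
      finally show ?case unfolding e .
    qed
    from this[of d] show ?thesis
      using moment_cong[of d "\<lambda>a. if a < d then v a else 0" v m B] by simp
  qed
  show ?thesis using x
  proof (induction rule: sum_cone_induct)
    case zero
    then show ?case by (simp only: minus_zero sum_cone_zero)
  next
    case (add v x)
    show ?case unfolding minus_add_distrib by (rule sum_cone_add[OF neg add(2)])
  qed
qed

section \<open>From positivity on moments to operators\<close>

text \<open>
  The Hahn-Banach functional \<open>\<phi>\<close> lives on families of quadratic forms. Let \<open>g\<close> be a linear projection of
  \<open>\<real>\<^sup>m\<close> onto the subspace \<open>K\<close> spanned by the vectors \<open>form_vec d m B z\<close>, and \<open>k\<^sub>i\<close> the image of the
  \<open>i\<close>-th unit vector. The operator \<open>S\<^sub>i\<close> is obtained from the form \<open>- \<phi> (k\<^sub>i \<otimes> |x\<rangle>\<langle>y|)\<close>, symmetrised.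
  The projection is needed because only directions in \<open>K\<close> are controlled by \<open>q\<close>. It does not change
  \<open>\<phi>\<close> on moments, because these have values in \<open>K\<close>.
\<close>
lemma operators_of_moment_positivity:
  fixes q :: "(nat \<Rightarrow> 'h::complex_hilbert_space) \<Rightarrow> real"
  assumes B: "\<forall>i\<in>{1..m}. B i \<in> herm_mat d"
    and indef: "indefinite_subspace d (real_span d m B)"
    and hom: "\<And>c v. c > 0 \<Longrightarrow> q (\<lambda>a. c *\<^sub>R v a) = c\<^sup>2 * q v"
    and bound: "\<And>z :: nat \<Rightarrow> complex. \<exists>C\<ge>0. \<forall>x. q (\<lambda>a. z a *\<^sub>C x) \<le> C * (norm x)\<^sup>2"
    and pos: "\<And>vs. sum_list (map (moment d m B) vs) = 0 \<Longrightarrow> 0 \<le> sum_list (map q vs)"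
  shows "\<exists>S. (\<forall>i. S i \<in> herm_ops) \<and> (\<forall>v. 0 \<le> q v + (\<Sum>i=1..m. Re (op_form d (B i) (S i) v)))"
proof -
  let ?K = "sum_cone (form_vec d m B)"
  let ?\<delta> = "\<lambda>i j. if j = i then 1 else 0 :: real"
  let ?mom = "moment d m B :: (nat \<Rightarrow> 'h) \<Rightarrow> 'h \<Rightarrow> nat \<Rightarrow> real"
  have Ksym: "- k \<in> ?K" if "k \<in> ?K" for k by (rule form_vec_cone_symmetric[OF B indef that])
  define Z where "Z = {(sum_list (map ?mom vs), sum_list (map q vs)) | vs. True}"
  have ZI: "(sum_list (map ?mom vs), sum_list (map q vs)) \<in> Z" for vs unfolding Z_def by blast
  have "\<exists>\<phi>. linear \<phi> \<and> (\<forall>(x, t)\<in>Z. \<phi> x \<le> t)"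
  proof (rule linear_below_convex_cone)
    show "(0, 0) \<in> Z" using ZI[of "[]"] by simp
  next
    fix x s y t assume "(x, s) \<in> Z" "(y, t) \<in> Z"
    then obtain vs ws where "x = sum_list (map ?mom vs)" "s = sum_list (map q vs)"
        "y = sum_list (map ?mom ws)" "t = sum_list (map q ws)" by (auto simp: Z_def)
    then show "(x + y, s + t) \<in> Z" using ZI[of "vs @ ws"] by simp
  next
    fix c x t assume c: "(c::real) > 0" and "(x, t) \<in> Z"
    then obtain vs where vs: "x = sum_list (map ?mom vs)" "t = sum_list (map q vs)" by (auto simp: Z_def)
    have "q (\<lambda>a. sqrt c *\<^sub>R v a) = c *\<^sub>R q v" for v using c hom[of "sqrt c" v] by simp
    moreover have "moment d m B (\<lambda>a. sqrt c *\<^sub>R v a) = c *\<^sub>R moment d m B v" for v :: "nat \<Rightarrow> 'h"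
      using c by (simp add: moment_scaleR)
    ultimately show "(c *\<^sub>R x, c * t) \<in> Z"
      using ZI[of "map (\<lambda>v a. sqrt c *\<^sub>R v a) vs"]
      by (simp add: comp_def sum_list_map_scaleR vs sum_list_const_mult)
  next
    fix x t assume "(x, t) \<in> Z"
    then have "x \<in> sum_cone ?mom" by (auto simp: Z_def sum_cone_def)
    from moment_cone_symmetric[OF Ksym this] show "\<exists>s. (- x, s) \<in> Z"
      by (auto simp: Z_def sum_cone_def)
  next
    fix t assume "(0, t) \<in> Z"
    then obtain vs where "sum_list (map ?mom vs) = 0" "t = sum_list (map q vs)" by (auto simp: Z_def)
    then show "0 \<le> t" using pos by simp
  qed
  then obtain \<phi> where lin: "linear \<phi>" and Z: "\<And>x t. (x, t) \<in> Z \<Longrightarrow> \<phi> x \<le> t" by blast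
  have le: "\<phi> (?mom v) \<le> q v" for v using Z[OF ZI[of "[v]"]] by simp

  have "real_vector.subspace ?K"
  proof (rule real_vector.subspaceI)
    fix c k assume k: "k \<in> ?K"
    have "c *\<^sub>R k \<in> ?K" if "c \<ge> 0" "k \<in> ?K" for c k
      by (rule sum_cone_scale[OF that(2), of "\<lambda>z a. of_real (sqrt c) * z a"])
        (use that(1) in \<open>simp add: form_vec_scale\<close>)
    from this[of c k] this[of "- c" "- k"] show "c *\<^sub>R k \<in> ?K"
      using k Ksym[OF k] by (cases "c \<ge> 0") auto
  qed (auto intro: sum_cone_zero sum_cone_add)
  then obtain g where g: "range g \<subseteq> ?K" "linear g" "\<And>k. k \<in> ?K \<Longrightarrow> g k = k"
    using real_vector.linear_exists_left_inverse_on[of id ?K]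
    by (auto simp: linear_id id_def module_hom_ident)

  \<comment> \<open>the quadratic form of \<open>(|x\<rangle>\<langle>y| + |y\<rangle>\<langle>x|) / 2\<close>\<close>
  define rk where "rk x y u = Re (cinner x u * cinner u y)" for x y u :: 'h
  define tens where "tens x y k = (\<lambda>u. rk x y u *\<^sub>R k)" for x y :: 'h and k :: "nat \<Rightarrow> real"
  define t where "t i x y = - \<phi> (tens x y (g (?\<delta> i)))" for i x y
  \<comment> \<open>\<open>\<phi> \<le> q\<close> at elementary tensors bounds the diagonal from above in each direction \<open>k \<in> K\<close>;
    used for both \<open>k\<^sub>i\<close> and \<open>- k\<^sub>i\<close>, it bounds the absolute value\<close>
  have upper: "\<exists>C\<ge>0. \<forall>x. \<phi> (tens x x k) \<le> C * (norm x)\<^sup>2" if "k \<in> ?K" for k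
    using that
  proof (induction rule: sum_cone_induct)
    case zero
    have "tens x x 0 = 0" for x by (simp add: tens_def zero_fun_def scaleR_fun_def)
    then show ?case by (intro exI[of _ 0]) (simp only: linear_0[OF lin], simp)
  next
    case (add z k)
    then obtain C where C: "C \<ge> 0" "\<And>x. \<phi> (tens x x k) \<le> C * (norm x)\<^sup>2" by blast
    obtain D where D: "D \<ge> 0" "\<And>x. q (\<lambda>a. z a *\<^sub>C x) \<le> D * (norm x)\<^sup>2" using bound by blast
    have sum: "\<phi> (tens x x (form_vec d m B z + k)) \<le> (C + D) * (norm x)\<^sup>2" for x
    proof -
      have "rk x x u = (cmod (cinner u x))\<^sup>2" for u
        unfolding rk_def cinner_commute[of x u] using complex_norm_square[of "cinner u x"]
        by (metis Re_complex_of_real mult.commute)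
      then have "tens x x (form_vec d m B z + k) = ?mom (\<lambda>a. z a *\<^sub>C x) + tens x x k"
        unfolding tens_def moment_elementary_tensor by (auto simp: scaleR_add_right)
      then show ?thesis
        using le[of "\<lambda>a. z a *\<^sub>C x"] C(2)[of x] D(2)[of x] by (simp add: linear_add[OF lin] distrib_right)
    qed
    show ?case by (intro exI[of _ "C + D"] conjI allI sum add_nonneg_nonneg C(1) D(1))
  qed
  have tens_minus: "tens x y (- k) = - tens x y k" for x y k
    by (auto simp: tens_def fun_eq_iff)
  have "\<exists>S\<in>herm_ops. \<forall>x y. inner x (S y) = t i x y" for i
  proof -
    let ?k = "g (?\<delta> i)"
    have k: "?k \<in> ?K" using g(1) by blast
    obtain C where C: "C \<ge> 0" "\<And>x. \<phi> (tens x x ?k) \<le> C * (norm x)\<^sup>2" using upper[OF k] by blast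
    obtain D where D: "D \<ge> 0" "\<And>x. \<phi> (tens x x (- ?k)) \<le> D * (norm x)\<^sup>2"
      using upper[OF Ksym[OF k]] by blast
    show ?thesis
    proof (rule bounded_symmetric_form_operator[where C = "C + D"])
      fix x y
      have add: "tens x (y + z) ?k = tens x y ?k + tens x z ?k" for y z
        by (auto simp: tens_def rk_def cinner_add_right distrib_left scaleR_add_left)
      have scale: "tens x (c *\<^sub>R y) ?k = c *\<^sub>R tens x y ?k" for y c
        by (auto simp: tens_def rk_def cinner_scaleR_right scaleR_fun_def fun_eq_iff algebra_simps)
      show "linear (t i x)"
        unfolding t_def
        by (intro linearI)
          (simp_all only: add scale linear_add[OF lin] linear_scale[OF lin], simp_all)
      have "rk x y = rk y x"
        unfolding rk_def cinner_commute[of x] cinner_commute[of y] by (auto simp: fun_eq_iff)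
      then show "t i x y = t i y x" by (simp add: t_def tens_def)
      have "rk (\<i> *\<^sub>C x) (\<i> *\<^sub>C y) = rk x y"
        by (simp add: rk_def cinner_scaleC_left cinner_scaleC_right fun_eq_iff)
      then show "t i (\<i> *\<^sub>C x) (\<i> *\<^sub>C y) = t i x y" by (simp add: t_def tens_def)
      have "C * (norm x)\<^sup>2 \<ge> 0" "D * (norm x)\<^sup>2 \<ge> 0" using C(1) D(1) by simp_all
      then show "\<bar>t i x x\<bar> \<le> (C + D) * (norm x)\<^sup>2"
        using C(2)[of x] D(2)[of x]
        by (simp add: t_def tens_minus linear_neg[OF lin] distrib_right)
    qed
  qed
  then obtain S where S: "\<And>i. S i \<in> herm_ops" "\<And>i x y. inner x (S i y) = t i x y" by metis
  have "0 \<le> q v + (\<Sum>i=1..m. Re (op_form d (B i) (S i) v))" for v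
  proof -
    have one: "Re (op_form d (B i) (S i) v) = - \<phi> (\<lambda>u. ?mom v u i *\<^sub>R g (?\<delta> i))"
      if i: "i \<in> {1..m}" for i
    proof -
      let ?k = "g (?\<delta> i)" and ?w = "\<lambda>a b. B i $$ (a, b) *\<^sub>C v b"
      have scale: "S i (c *\<^sub>C x) = c *\<^sub>C S i x" for c x
        using S(1)[of i] by (simp add: herm_ops_def bounded_ops_def)
      have "Re (op_form d (B i) (S i) v) = (\<Sum>a<d. \<Sum>b<d. t i (v a) (?w a b))"
        unfolding op_form_def Re_sum S(2)[symmetric] Re_cinner[symmetric] scale cinner_scaleC_right ..
      also have "\<dots> = - \<phi> (\<Sum>a<d. \<Sum>b<d. tens (v a) (?w a b) ?k)"
        unfolding t_def linear_sum[OF lin] sum_negf ..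
      also have "(\<Sum>a<d. \<Sum>b<d. tens (v a) (?w a b) ?k) = (\<lambda>u. ?mom v u i *\<^sub>R ?k)"
      proof
        fix u
        have "rk (v a) (?w a b) u = Re (B i $$ (a, b) * cinner (cinner u (v a)) (id (cinner u (v b))))" for a b
          unfolding rk_def cinner_commute[of "v a" u] cinner_complex_def cinner_scaleC_right
          by (simp add: mult_ac)
        then have "?mom v u i = (\<Sum>a<d. \<Sum>b<d. rk (v a) (?w a b) u)"
          using i by (simp add: moment_def form_vec_def op_form_def)
        then show "(\<Sum>a<d. \<Sum>b<d. tens (v a) (?w a b) ?k) u = ?mom v u i *\<^sub>R ?k"
          by (simp add: sum_fun_apply tens_def scaleR_left.sum)
      qed
      finally show ?thesis .
    qed
    have "(\<Sum>i=1..m. (\<lambda>u. ?mom v u i *\<^sub>R g (?\<delta> i))) = ?mom v"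
    proof
      fix u
      have mem: "?mom v u \<in> ?K" unfolding moment_def by (rule sum_cone_mem)
      have "?mom v u = (\<Sum>i\<in>{1..m}. ?mom v u i *\<^sub>R ?\<delta> i)"
        by (intro fun_expand_delta sum_cone_form_vec_outside[OF mem]) auto
      from arg_cong[OF this, of g]
      have "g (?mom v u) = (\<Sum>i\<in>{1..m}. ?mom v u i *\<^sub>R g (?\<delta> i))"
        by (simp only: linear_sum[OF g(2)] linear_scale[OF g(2)])
      then show "(\<Sum>i=1..m. (\<lambda>u. ?mom v u i *\<^sub>R g (?\<delta> i))) u = ?mom v u"
        unfolding sum_fun_apply g(3)[OF mem] by simp
    qed
    moreover have "(\<Sum>i=1..m. Re (op_form d (B i) (S i) v))
        = - \<phi> (\<Sum>i=1..m. (\<lambda>u. ?mom v u i *\<^sub>R g (?\<delta> i)))"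
      by (simp add: one linear_sum[OF lin] sum_negf)
    ultimately show ?thesis using le[of v] by simp
  qed
  then show ?thesis using S(1) by blast
qed

text \<open>
  By polarization, a complex matrix is determined by its values \<open>x\<^sup>* M x\<close>.
\<close>
lemma op_form_id_eq_zero:
  assumes M: "M \<in> carrier_mat r r" and zero: "\<And>x :: nat \<Rightarrow> complex. op_form r M id x = 0"
  shows "M = 0\<^sub>m r r"
proof (rule eq_matI)
  fix i j assume "i < dim_row (0\<^sub>m r r :: complex mat)" "j < dim_col (0\<^sub>m r r :: complex mat)"
  then have ij: "i < r" "j < r" by auto
  let ?x = "\<lambda>a. if a = i then 1 else 0 :: complex" and ?y = "\<lambda>a. if a = j then 1 else 0 :: complex"
  let ?f = "\<lambda>k. op_form r M id (\<lambda>a. ?x a + k * ?y a)"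
  have "?f 1 - ?f (- 1) - \<i> * (?f \<i> - ?f (- \<i>)) = (\<Sum>a<r. \<Sum>b<r. 4 * (M $$ (a, b) * (?x a * ?y b)))"
    unfolding op_form_def sum_subtractf[symmetric] sum_distrib_left
    by (intro sum.cong refl) (simp add: cinner_complex_def algebra_simps)
  also have "\<dots> = (\<Sum>a<r. if a = i then 4 * M $$ (a, j) else 0)"
  proof (intro sum.cong refl)
    fix a
    have "(\<Sum>b<r. 4 * (M $$ (a, b) * (?x a * ?y b))) = (\<Sum>b<r. if b = j then 4 * M $$ (a, b) * ?x a else 0)"
      by (intro sum.cong) auto
    then show "(\<Sum>b<r. 4 * (M $$ (a, b) * (?x a * ?y b))) = (if a = i then 4 * M $$ (a, j) else 0)"
      using ij by simp
  qed
  also have "\<dots> = 4 * M $$ (i, j)" using ij by simp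
  finally show "M $$ (i, j) = 0\<^sub>m r r $$ (i, j)" using ij by (simp add: zero)
qed (use M in auto)

section \<open>The equivalence\<close>

lemma mat_tuple_cong: "(\<And>c. c < r \<Longrightarrow> x c = y c) \<Longrightarrow> mat_tuple r W x = mat_tuple r W y"
  by (simp add: mat_tuple_def cong: if_cong)

lemma cinner_mat_tuple:
  fixes e :: "nat \<Rightarrow> 'h::complex_hilbert_space"
  shows "cinner u (mat_tuple r W e a) = mat_tuple r W (\<lambda>c. cinner u (e c)) a"
  by (simp add: mat_tuple_def cinner_sum_right cinner_scaleC_right scaleC_complex_def)

lemma tensor_cinner_sum_right:
  "tensor_cinner d u ((\<Sum>i\<in>I. F i) v) = (\<Sum>i\<in>I. tensor_cinner d u (F i v))"
  unfolding tensor_cinner_def sum_fun_apply cinner_sum_right by (rule sum.swap)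

lemma tensor_cinner_add_right:
  "tensor_cinner d u ((F + G) v) = tensor_cinner d u (F v) + tensor_cinner d u (G v)"
  by (simp add: tensor_cinner_def cinner_add_right sum.distrib)

lemma sum_list_map_nth: "sum_list (map f xs) = (\<Sum>j=1..length xs. f (xs ! (j - 1)))"
  for f :: "'b \<Rightarrow> 'a::comm_monoid_add"
  by (simp add: sum_list_sum_nth sum.atLeast1_atMost_eq atLeast0LessThan)

lemma tuples_common_expansion:
  fixes vs :: "(nat \<Rightarrow> 'h::complex_hilbert_space) list"
  shows "\<exists>r e W. enat r \<le> hilbert_dim TYPE('h)
    \<and> (\<forall>i<r. \<forall>j<r. cinner (e i) (e j) = (if i = j then 1 else 0))
    \<and> (\<forall>j. W j \<in> carrier_mat d r)
    \<and> (\<forall>j<length vs. \<forall>a<d. mat_tuple r (W j) e a = (vs ! j) a)"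
proof -
  have "finite (\<Union>v\<in>set vs. v ` {..<d})" by simp
  from complex_orthonormal_basis[OF this] obtain r and e :: "nat \<Rightarrow> 'h"
    where e: "enat r \<le> hilbert_dim TYPE('h)"
        "\<forall>i<r. \<forall>j<r. cinner (e i) (e j) = (if i = j then 1 else 0)"
      and sp: "\<forall>x\<in>(\<Union>v\<in>set vs. v ` {..<d}). \<exists>c. x = (\<Sum>i<r. c i *\<^sub>C e i)" by blast
  have "\<forall>j a. \<exists>c. j < length vs \<longrightarrow> a < d \<longrightarrow> (vs ! j) a = (\<Sum>i<r. c i *\<^sub>C e i)"
  proof (intro allI)
    fix j a
    show "\<exists>c. j < length vs \<longrightarrow> a < d \<longrightarrow> (vs ! j) a = (\<Sum>i<r. c i *\<^sub>C e i)"
    proof (cases "j < length vs \<and> a < d")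
      case True
      then have "(vs ! j) a \<in> (\<Union>v\<in>set vs. v ` {..<d})" by auto
      then show ?thesis using sp by blast
    qed auto
  qed
  then obtain c where c: "\<And>j a. j < length vs \<Longrightarrow> a < d \<Longrightarrow> (vs ! j) a = (\<Sum>i<r. c j a i *\<^sub>C e i)"
    by metis
  show ?thesis
    by (intro exI[of _ r] exI[of _ e] exI[of _ "\<lambda>j. mat d r (\<lambda>(a, i). c j a i)"])
      (use e c in \<open>auto simp: mat_tuple_def\<close>)
qed

text \<open>
  In the common orthonormal basis \<open>e\<close> of the entries, the \<open>j\<close>-th tuple is \<open>(W\<^sub>j \<otimes> 1) e\<close>. For any numbers
  \<open>x\<^sub>c\<close> there is a vector \<open>u\<close> with \<open>\<langle>u, e\<^sub>c\<rangle> = x\<^sub>c\<close>, and the sum of the moments at \<open>u\<close> is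
  \<open>x\<^sup>* (\<Sum>\<^sub>j W\<^sub>j\<^sup>* B\<^sub>i W\<^sub>j) x\<close>. So \<open>zero\<close> says that these matrices vanish, and positivity of the compressed
  polynomials, tested on \<open>e\<close>, is the claim.
\<close>
lemma evaluation_nonneg_of_moment_zero:
  fixes T :: "nat \<Rightarrow> 'h::complex_hilbert_space \<Rightarrow> 'h" and vs :: "(nat \<Rightarrow> 'h) list"
  assumes p: "p \<in> nc_herm_mat d n"
    and B: "\<forall>i\<in>{1..m}. B i \<in> herm_mat d"
    and T: "\<forall>i\<in>{1..n}. T i \<in> herm_ops"
    and psd: "\<And>r N W. enat r \<le> hilbert_dim TYPE('h) \<Longrightarrow> (\<forall>j\<in>{1..N}. W j \<in> carrier_mat d r) \<Longrightarrow>
        (\<forall>i\<in>{1..m}. mat_sum r r (\<lambda>j. mat_adjoint (W j) * B i * W j) {1..N} = 0\<^sub>m r r) \<Longrightarrow>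
        op_psd r (\<Sum>j=1..(N::nat). nc_eval (nc_compress (W j) p) T)"
    and zero: "sum_list (map (moment d m B) vs) = 0"
  shows "0 \<le> sum_list (map (\<lambda>v. Re (tensor_cinner d v (nc_eval p T v))) vs)"
proof -
  have pc: "p \<in> carrier_mat d d" using p by (simp add: nc_herm_mat_def nc_mat_def)
  obtain r and e :: "nat \<Rightarrow> 'h" and W' where r: "enat r \<le> hilbert_dim TYPE('h)"
    and on: "\<And>i j. i < r \<Longrightarrow> j < r \<Longrightarrow> cinner (e i) (e j) = (if i = j then 1 else 0)"
    and W': "\<And>j. W' j \<in> carrier_mat d r"
    and exp': "\<And>j a. j < length vs \<Longrightarrow> a < d \<Longrightarrow> mat_tuple r (W' j) e a = (vs ! j) a"
    using tuples_common_expansion[of d vs] by blast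
  define W where "W j = W' (j - 1)" for j
  define N where "N = length vs"
  let ?v = "\<lambda>j. vs ! (j - 1)"
  have W: "W j \<in> carrier_mat d r" for j by (simp add: W_def W')
  have exp: "mat_tuple r (W j) e a = ?v j a" if "j \<in> {1..N}" "a < d" for j a
    unfolding W_def using that by (intro exp') (auto simp: N_def)
  have "mat_sum r r (\<lambda>j. mat_adjoint (W j) * B i * W j) {1..N} = 0\<^sub>m r r" (is "?M = _")
    if i: "i \<in> {1..m}" for i
  proof (rule op_form_id_eq_zero)
    have Bi: "B i \<in> herm_mat d" "B i \<in> carrier_mat d d" using B i by (auto simp: herm_mat_def)
    fix x :: "nat \<Rightarrow> complex"
    define u where "u = (\<Sum>c<r. cnj (x c) *\<^sub>C e c)"
    have ux: "cinner u (e c) = x c" if "c < r" for c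
    proof -
      have "cinner u (e c) = (\<Sum>k<r. if k = c then x k else 0)"
        unfolding u_def cinner_sum_left cinner_scaleC_left using on that by (intro sum.cong) auto
      then show ?thesis using that by simp
    qed
    have "op_form r ?M id x = (\<Sum>j=1..N. op_form d (B i) id (mat_tuple r (W j) x))"
      unfolding op_form_mat_sum by (intro sum.cong refl op_form_compress W Bi id_bounded_ops)
    also have "\<dots> = (\<Sum>j=1..N. op_form d (B i) id (\<lambda>a. cinner u (?v j a)))"
    proof (intro sum.cong refl op_form_cong)
      fix j a assume ja: "j \<in> {1..N}" "a < d"
      have "mat_tuple r (W j) x a = mat_tuple r (W j) (\<lambda>c. cinner u (e c)) a"
        by (rule fun_cong[OF mat_tuple_cong]) (simp add: ux)
      then show "mat_tuple r (W j) x a = cinner u (?v j a)"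
        by (simp add: cinner_mat_tuple[symmetric] exp[OF ja])
    qed
    also have "\<dots> = 0"
    proof (rule complex_eqI)
      have "Re (\<Sum>j=1..N. op_form d (B i) id (\<lambda>a. cinner u (?v j a)))
          = (\<Sum>j=1..N. moment d m B (?v j)) u i"
        unfolding sum_fun_apply Re_sum using i by (simp add: moment_def form_vec_def)
      also have "\<dots> = 0" using zero unfolding sum_list_map_nth N_def by simp
      finally show "Re (\<Sum>j=1..N. op_form d (B i) id (\<lambda>a. cinner u (?v j a))) = Re 0" by simp
      show "Im (\<Sum>j=1..N. op_form d (B i) id (\<lambda>a. cinner u (?v j a))) = Im 0"
        by (simp add: op_form_herm_real[OF Bi(1) id_herm_ops])
    qed
    finally show "op_form r ?M id x = 0" .
  qed (simp add: mat_sum_def)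
  then have psd': "op_psd r (\<Sum>j=1..N. nc_eval (nc_compress (W j) p) T)"
    using psd[OF r] W by blast
  \<comment> \<open>tuples in \<open>tensor_space r\<close> vanish from \<open>r\<close> on, while \<open>e\<close> is arbitrary there\<close>
  define e' where "e' = (\<lambda>c. if c < r then e c else 0)"
  have "e' \<in> tensor_space r" by (simp add: e'_def tensor_space_def)
  with psd' have "0 \<le> tensor_cinner r e' ((\<Sum>j=1..N. nc_eval (nc_compress (W j) p) T) e')"
    by (simp add: op_psd_def)
  also have "\<dots> = (\<Sum>j=1..N. tensor_cinner d (mat_tuple r (W j) e') (nc_eval p T (mat_tuple r (W j) e')))"
    unfolding tensor_cinner_sum_right by (intro sum.cong refl nc_eval_compress[OF p T W])
  also have "\<dots> = (\<Sum>j=1..N. tensor_cinner d (?v j) (nc_eval p T (?v j)))"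
  proof (intro sum.cong refl)
    fix j assume j: "j \<in> {1..N}"
    have "mat_tuple r (W j) e' a = ?v j a" if "a < d" for a
      using exp[OF j that] mat_tuple_cong[of r e' e "W j"] by (simp add: e'_def)
    then show "tensor_cinner d (mat_tuple r (W j) e') (nc_eval p T (mat_tuple r (W j) e'))
        = tensor_cinner d (?v j) (nc_eval p T (?v j))"
      unfolding tensor_cinner_nc_eval[OF pc finite_nc_support subset_refl]
      by (intro sum.cong refl op_form_cong)
  qed
  finally show ?thesis
    unfolding sum_list_map_nth N_def by (simp add: less_eq_complex_def)
qed

lemma evaluation_scaleR:
  fixes T :: "nat \<Rightarrow> 'h::complex_hilbert_space \<Rightarrow> 'h"
  assumes p: "p \<in> nc_herm_mat d n" and T: "\<forall>i\<in>{1..n}. T i \<in> herm_ops"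
  shows "tensor_cinner d (\<lambda>a. c *\<^sub>R v a) (nc_eval p T (\<lambda>a. c *\<^sub>R v a))
    = of_real (c\<^sup>2) * tensor_cinner d v (nc_eval p T v)"
proof -
  have pc: "p \<in> carrier_mat d d" using p by (simp add: nc_herm_mat_def nc_mat_def)
  show ?thesis
    unfolding tensor_cinner_nc_eval[OF pc finite_nc_support subset_refl] sum_distrib_left
  proof (intro sum.cong refl)
    fix w assume "w \<in> nc_support p"
    then have "word_eval T w \<in> bounded_ops" using word_eval_bounded[OF T] nc_support_words[OF p] by blast
    then have "word_eval T w (c *\<^sub>R x) = c *\<^sub>R word_eval T w x" for x
      by (simp add: bounded_ops_def scaleR_scaleC)
    then show "op_form d (nc_coeff p w) (word_eval T w) (\<lambda>a. c *\<^sub>R v a)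
        = of_real (c\<^sup>2) * op_form d (nc_coeff p w) (word_eval T w) v"
      by (simp add: op_form_def sum_distrib_left power2_eq_square scaleR_scaleC cinner_scaleC_left
          cinner_scaleC_right mult_ac)
  qed
qed

text \<open>
  For words in the \<open>T\<^sub>i\<close> in the role of \<open>S\<close>, this is how the boundedness of the \<open>T\<^sub>i\<close> is passed on to the
  operators that solve the inequality.
\<close>
lemma op_form_elementary_tensor_bound:
  assumes S: "S \<in> bounded_ops"
  shows "\<exists>C\<ge>0. \<forall>x. Re (op_form d P S (\<lambda>a. z a *\<^sub>C x)) \<le> C * (norm x)\<^sup>2"
proof -
  obtain M where M: "M \<ge> 0" "\<And>x. norm (S x) \<le> norm x * M"
    using S bounded_linear.nonneg_bounded[of S] by (auto simp: bounded_ops_def)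
  have scale: "S (c *\<^sub>C x) = c *\<^sub>C S x" for c x using S by (simp add: bounded_ops_def)
  define k where "k a b = P $$ (a, b) * (cnj (z a) * z b)" for a b
  have "Re (op_form d P S (\<lambda>a. z a *\<^sub>C x)) \<le> (\<Sum>a<d. \<Sum>b<d. cmod (k a b) * M) * (norm x)\<^sup>2" for x
  proof -
    have "Re (op_form d P S (\<lambda>a. z a *\<^sub>C x)) = (\<Sum>a<d. \<Sum>b<d. Re (k a b * cinner x (S x)))"
      unfolding op_form_def Re_sum scale cinner_scaleC_left cinner_scaleC_right k_def
      by (simp add: mult_ac)
    also have "\<dots> \<le> (\<Sum>a<d. \<Sum>b<d. cmod (k a b) * M * (norm x)\<^sup>2)"
    proof (intro sum_mono)
      fix a b
      have "Re (k a b * cinner x (S x)) \<le> cmod (k a b) * (norm x * norm (S x))"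
        using Re_mult_cinner_le[of "k a b" x "S x"] by linarith
      also have "\<dots> \<le> cmod (k a b) * (norm x * (norm x * M))"
        by (intro mult_left_mono M) auto
      finally show "Re (k a b * cinner x (S x)) \<le> cmod (k a b) * M * (norm x)\<^sup>2"
        by (simp add: power2_eq_square mult_ac)
    qed
    finally show ?thesis by (simp add: sum_distrib_right)
  qed
  then show ?thesis
    using M(1) by (intro exI[of _ "\<Sum>a<d. \<Sum>b<d. cmod (k a b) * M"]) (auto intro!: sum_nonneg)
qed

lemma evaluation_elementary_tensor_bound:
  fixes T :: "nat \<Rightarrow> 'h::complex_hilbert_space \<Rightarrow> 'h"
  assumes p: "p \<in> nc_herm_mat d n" and T: "\<forall>i\<in>{1..n}. T i \<in> herm_ops"
  shows "\<exists>C\<ge>0. \<forall>x. Re (tensor_cinner d (\<lambda>a. z a *\<^sub>C x) (nc_eval p T (\<lambda>a. z a *\<^sub>C x))) \<le> C * (norm x)\<^sup>2"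
proof -
  have pc: "p \<in> carrier_mat d d" using p by (simp add: nc_herm_mat_def nc_mat_def)
  have "\<forall>w\<in>nc_support p. \<exists>C\<ge>0. \<forall>x.
      Re (op_form d (nc_coeff p w) (word_eval T w) (\<lambda>a. z a *\<^sub>C x)) \<le> C * (norm x)\<^sup>2"
    using op_form_elementary_tensor_bound word_eval_bounded[OF T] nc_support_words[OF p] by blast
  then obtain C where C: "\<And>w. w \<in> nc_support p \<Longrightarrow> C w \<ge> 0"
    "\<And>w x. w \<in> nc_support p \<Longrightarrow>
      Re (op_form d (nc_coeff p w) (word_eval T w) (\<lambda>a. z a *\<^sub>C x)) \<le> C w * (norm x)\<^sup>2"
    by metis
  show ?thesis
    unfolding tensor_cinner_nc_eval[OF pc finite_nc_support subset_refl] Re_sum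
    by (intro exI[of _ "\<Sum>w\<in>nc_support p. C w"])
      (auto simp: sum_distrib_right intro!: sum_nonneg sum_mono C)
qed

theorem theorem3p2:
  fixes d n m :: nat
    and p :: "ncpoly mat"
    and B :: "nat \<Rightarrow> complex mat"
    and T :: "nat \<Rightarrow> 'h::complex_hilbert_space \<Rightarrow> 'h"
  assumes "p \<in> nc_herm_mat d n"
    and "\<forall>i\<in>{1..m}. B i \<in> herm_mat d"
    and "indefinite_subspace d (real_span d m B)"
    and "\<forall>i\<in>{1..n}. T i \<in> herm_ops"
  shows
    "(\<exists>S :: nat \<Rightarrow> 'h \<Rightarrow> 'h. (\<forall>i\<in>{1..m}. S i \<in> herm_ops)
        \<and> op_psd d (nc_eval p T + (\<Sum>i=1..m. tensor_op (B i) (S i))))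
     \<longleftrightarrow>
     (\<forall>r::nat. enat r \<le> hilbert_dim TYPE('h) \<longrightarrow>
        (\<forall>(N::nat) W :: nat \<Rightarrow> complex mat.
           (\<forall>j\<in>{1..N}. W j \<in> carrier_mat d r)
           \<and> (\<forall>i\<in>{1..m}. mat_sum r r (\<lambda>j. mat_adjoint (W j) * B i * W j) {1..N} = 0\<^sub>m r r)
           \<longrightarrow> op_psd r (\<Sum>j=1..N. nc_eval (nc_compress (W j) p) T)))"
    (is "?lhs \<longleftrightarrow> ?rhs")
proof
  have Bc: "B i \<in> carrier_mat d d" if "i \<in> {1..m}" for i
    using that assms(2) by (auto simp: herm_mat_def)
  have pencil: "tensor_cinner d v ((nc_eval p T + (\<Sum>i=1..m. tensor_op (B i) (S i))) v)
      = tensor_cinner d v (nc_eval p T v) + (\<Sum>i=1..m. op_form d (B i) (S i) v)"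
    for v and S :: "nat \<Rightarrow> 'h \<Rightarrow> 'h"
    unfolding tensor_cinner_add_right tensor_cinner_sum_right
    by (simp add: tensor_cinner_tensor_op Bc)
  {
    assume ?lhs
    then obtain S :: "nat \<Rightarrow> 'h \<Rightarrow> 'h" where S: "\<And>i. i \<in> {1..m} \<Longrightarrow> S i \<in> herm_ops"
      and psd: "op_psd d (nc_eval p T + (\<Sum>i=1..m. tensor_op (B i) (S i)))" by blast
    show ?rhs
    proof (intro allI impI, unfold op_psd_def, intro ballI)
      fix r N :: nat and W :: "nat \<Rightarrow> complex mat" and x :: "nat \<Rightarrow> 'h"
      assume W: "(\<forall>j\<in>{1..N}. W j \<in> carrier_mat d r)
        \<and> (\<forall>i\<in>{1..m}. mat_sum r r (\<lambda>j. mat_adjoint (W j) * B i * W j) {1..N} = 0\<^sub>m r r)"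
      let ?y = "\<lambda>j. mat_tuple r (W j) x"
      have "?y j \<in> tensor_space d" if "j \<in> {1..N}" for j
      proof -
        have "dim_row (W j) = d" using W that by auto
        then show ?thesis by (simp add: tensor_space_def mat_tuple_def)
      qed
      then have "0 \<le> (\<Sum>j=1..N. tensor_cinner d (?y j)
          ((nc_eval p T + (\<Sum>i=1..m. tensor_op (B i) (S i))) (?y j)))"
        using psd by (intro sum_nonneg) (simp add: op_psd_def)
      also have "\<dots> = (\<Sum>j=1..N. tensor_cinner d (?y j) (nc_eval p T (?y j)))
          + (\<Sum>i=1..m. \<Sum>j=1..N. op_form d (B i) (S i) (?y j))"
        unfolding pencil sum.distrib unfolding sum.swap[where A = "{1..N}" and B = "{1..m}"] ..
      also have "(\<Sum>i=1..m. \<Sum>j=1..N. op_form d (B i) (S i) (?y j)) = 0"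
      proof (rule sum.neutral, rule ballI)
        fix i assume i: "i \<in> {1..m}"
        have Si: "S i \<in> bounded_ops" using S[OF i] by (simp add: herm_ops_def)
        have "(\<Sum>j=1..N. op_form d (B i) (S i) (?y j))
            = op_form r (mat_sum r r (\<lambda>j. mat_adjoint (W j) * B i * W j) {1..N}) (S i) x"
          unfolding op_form_mat_sum using W
          by (intro sum.cong refl op_form_compress[OF _ Bc[OF i] Si, symmetric]) auto
        also have "\<dots> = 0" using W i by (simp add: op_form_def)
        finally show "(\<Sum>j=1..N. op_form d (B i) (S i) (?y j)) = 0" .
      qed
      also have "(\<Sum>j=1..N. tensor_cinner d (?y j) (nc_eval p T (?y j)))
          = tensor_cinner r x ((\<Sum>j=1..N. nc_eval (nc_compress (W j) p) T) x)"
        unfolding tensor_cinner_sum_right using W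
        by (intro sum.cong refl nc_eval_compress[OF assms(1,4), symmetric]) auto
      finally show "0 \<le> tensor_cinner r x ((\<Sum>j=1..N. nc_eval (nc_compress (W j) p) T) x)" by simp
    qed
  }
  assume rhs: ?rhs
  let ?q = "\<lambda>v. Re (tensor_cinner d v (nc_eval p T v))"
  have "\<exists>S. (\<forall>i. S i \<in> herm_ops) \<and> (\<forall>v. 0 \<le> ?q v + (\<Sum>i=1..m. Re (op_form d (B i) (S i) v)))"
  proof (rule operators_of_moment_positivity[OF assms(2,3)])
    show "?q (\<lambda>a. c *\<^sub>R v a) = c\<^sup>2 * ?q v" for c v
      unfolding evaluation_scaleR[OF assms(1,4)]
      by (simp only: times_complex.sel Re_complex_of_real Im_complex_of_real)
    show "\<exists>C\<ge>0. \<forall>x. ?q (\<lambda>a. z a *\<^sub>C x) \<le> C * (norm x)\<^sup>2" for z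
      by (rule evaluation_elementary_tensor_bound[OF assms(1,4)])
    show "0 \<le> sum_list (map ?q vs)" if "sum_list (map (moment d m B) vs) = 0" for vs
      by (rule evaluation_nonneg_of_moment_zero[OF assms(1,2,4) _ that]) (use rhs in blast)
  qed
  then obtain S :: "nat \<Rightarrow> 'h \<Rightarrow> 'h" where S: "\<And>i. S i \<in> herm_ops"
    and pos: "\<And>v. 0 \<le> ?q v + (\<Sum>i=1..m. Re (op_form d (B i) (S i) v))" by blast
  have "op_psd d (nc_eval p T + (\<Sum>i=1..m. tensor_op (B i) (S i)))"
    unfolding op_psd_def pencil
  proof
    fix v :: "nat \<Rightarrow> 'h"
    show "0 \<le> tensor_cinner d v (nc_eval p T v) + (\<Sum>i=1..m. op_form d (B i) (S i) v)"
      using pos[of v] assms(2) nc_eval_herm_real[OF assms(1,4)] op_form_herm_real[OF _ S]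
      by (auto simp: less_eq_complex_def)
  qed
  then show ?lhs using S by blast
qed

end
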